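(* Let $d>0$ and $\beta>0$ be real. Let $\phi$ be any probability distribution on $\mathbb{R}$, and let $\zeta$ be any distribution on $\mathbb{Z}_{\ge0}$ with mean $d$ and finite second moment. Let $\mathbf{T}$ be the Galton–Watson tree with offspring distribution $\zeta$, and let $\mu_{\beta,\phi}$ be the Gibbs distribution on $\mathbf{T}$. Define $$\Delta_{\rm KS}(\beta,\phi)=\left(\mathbb{E}\left[\left(\frac{1-\exp(\beta J)}{1+\exp(\beta J)}\right)^2\right]\right)^{-1},\qquad J\sim\phi.$$ Then $\mu_{\beta,\phi}$ exhibits reconstruction if $d>\Delta_{\rm KS}(\beta,\phi)$, and exhibits non-reconstruction if $d<\Delta_{\rm KS}(\beta,\phi)$.
   Context: $\mathbf{T}$ is a rooted random tree, with root $r$, in which the numbers of children of the vertices are independent and each has law $\zeta$. Given $\mathbf{T}$ (restricted to its first $h$ generations), let $\{J_e\}$ be i.i.d. with law $\phi$, one for each edge. The random Gibbs measure is $$\mu(\sigma)\propto\exp\Big(\beta\sum_{\{u,w\}}\mathbf{1}\{\sigma(u)=\sigma(w)\}J_{\{u,w\}}\Big)$$ on $\{\pm1\}$-configurations of the vertices. Let $\mu_h$ be its marginal on the vertices at distance $h$ from $r$. The measure exhibits reconstruction if $$\limsup_{h\to\infty}\mathbb{E}_{\mathbf{T}}\Big[\mathbb{E}_{\mu}\big[\|\mu_h(\cdot\mid\sigma(r)=+1)-\mu_h(\cdot\mid\sigma(r)=-1)\|_{\rm TV}\,\big|\,\mathbf{T}\big]\Big]>0.$$ Here the inner expectation is over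 the couplings, and the total variation distance is taken to be $0$ when $\mathbf{T}$ has no vertex at distance $h$. The measure exhibits non-reconstruction if the limit equals $0$. *)

theory Defs
  imports "HOL-Probability.Probability"
begin

text \<open>
  Vertices are Ulam--Harris words: the root is the empty word and the children of \<open>v\<close> are
  \<open>v @ [i]\<close> for \<open>i < N v\<close>, where \<open>N v\<close> is the number of children of \<open>v\<close>.
\<close>

inductive_set gw_tree :: "(nat list \<Rightarrow> nat) \<Rightarrow> nat list set" for N where
  root: "[] \<in> gw_tree N"
| child: "v \<in> gw_tree N \<Longrightarrow> i < N v \<Longrightarrow> v @ [i] \<in> gw_tree N"

definition level :: "(nat list \<Rightarrow> nat) \<Rightarrow> nat \<Rightarrow> nat list set" where
  "level N h = {v \<in> gw_tree N. length v = h}"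

definition vertices :: "(nat list \<Rightarrow> nat) \<Rightarrow> nat \<Rightarrow> nat list set" where
  "vertices N h = {v \<in> gw_tree N. length v \<le> h}"

text \<open>An edge is represented by its lower endpoint: \<open>v\<close> stands for \<open>{butlast v, v}\<close>.\<close>

definition edges :: "(nat list \<Rightarrow> nat) \<Rightarrow> nat \<Rightarrow> nat list set" where
  "edges N h = vertices N h - {[]}"

definition configs :: "nat list set \<Rightarrow> (nat list \<Rightarrow> int) set" where
  "configs V = V \<rightarrow>\<^sub>E {- 1, 1}"

definition gibbs_weight ::
  "real \<Rightarrow> (nat list \<Rightarrow> nat) \<Rightarrow> (nat list \<Rightarrow> real) \<Rightarrow> nat \<Rightarrow> (nat list \<Rightarrow> int) \<Rightarrow> real" where
  "gibbs_weight \<beta> N J h \<sigma> =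
     exp (\<beta> * (\<Sum>v\<in>edges N h. of_bool (\<sigma> (butlast v) = \<sigma> v) * J v))"

definition gibbs ::
  "real \<Rightarrow> (nat list \<Rightarrow> nat) \<Rightarrow> (nat list \<Rightarrow> real) \<Rightarrow> nat \<Rightarrow> (nat list \<Rightarrow> int) pmf" where
  "gibbs \<beta> N J h = embed_pmf (\<lambda>\<sigma>. if \<sigma> \<in> configs (vertices N h)
     then gibbs_weight \<beta> N J h \<sigma> / (\<Sum>\<tau>\<in>configs (vertices N h). gibbs_weight \<beta> N J h \<tau>)
     else 0)"

lemma level_Suc: "level N (Suc h) = (\<Union>v\<in>level N h. (\<lambda>i. v @ [i]) ` {..<N v})"
proof (intro set_eqI iffI)
  fix w assume "w \<in> level N (Suc h)"
  then have "w \<in> gw_tree N" "length w = Suc h" by (auto simp: level_def)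
  then show "w \<in> (\<Union>v\<in>level N h. (\<lambda>i. v @ [i]) ` {..<N v})"
    by (cases rule: gw_tree.cases) (auto simp: level_def)
qed (auto simp: level_def intro: gw_tree.child)

lemma finite_level: "finite (level N h)"
proof (induction h)
  case 0
  have "level N 0 \<subseteq> {[]}" by (auto simp: level_def)
  then show ?case by (rule finite_subset) simp
qed (simp add: level_Suc)

lemma finite_vertices: "finite (vertices N h)"
proof -
  have "vertices N h = (\<Union>k\<le>h. level N k)" by (auto simp: vertices_def level_def)
  then show ?thesis by (simp add: finite_level)
qed

lemma finite_configs: "finite V \<Longrightarrow> finite (configs V)"
  by (simp add: configs_def finite_PiE)

lemma configs_nonempty: "configs V \<noteq> {}"
  by (simp add: configs_def PiE_eq_empty_iff)

lemma pmf_gibbs: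
  "pmf (gibbs \<beta> N J h) \<sigma> = (if \<sigma> \<in> configs (vertices N h)
     then gibbs_weight \<beta> N J h \<sigma> / (\<Sum>\<tau>\<in>configs (vertices N h). gibbs_weight \<beta> N J h \<tau>)
     else 0)"
proof -
  let ?C = "configs (vertices N h)"
  let ?w = "gibbs_weight \<beta> N J h"
  let ?f = "\<lambda>\<sigma>. if \<sigma> \<in> ?C then ?w \<sigma> / (\<Sum>\<tau>\<in>?C. ?w \<tau>) else 0"
  have fin: "finite ?C" by (simp add: finite_configs finite_vertices)
  have Z: "(\<Sum>\<tau>\<in>?C. ?w \<tau>) > 0"
    using fin configs_nonempty by (intro sum_pos) (auto simp: gibbs_weight_def)
  have nonneg: "0 \<le> ?f \<sigma>" for \<sigma>
    using Z by (simp add: gibbs_weight_def)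
  have "(\<integral>\<^sup>+\<sigma>. ennreal (?f \<sigma>) \<partial>count_space UNIV) = (\<Sum>\<sigma>\<in>?C. ennreal (?f \<sigma>))"
    using fin by (intro nn_integral_count_space'[of ?C]) auto
  also have "\<dots> = ennreal (\<Sum>\<sigma>\<in>?C. ?f \<sigma>)"
    by (intro sum_ennreal nonneg)
  also have "(\<Sum>\<sigma>\<in>?C. ?f \<sigma>) = 1"
    using Z by (simp flip: sum_divide_distrib)
  finally have "(\<integral>\<^sup>+\<sigma>. ennreal (?f \<sigma>) \<partial>count_space UNIV) = 1" by simp
  from pmf_embed_pmf[of ?f, OF nonneg this] show ?thesis
    unfolding gibbs_def .
qed

lemma gibbs_root_possible:
  assumes "s \<in> {- 1, 1}"
  shows "set_pmf (gibbs \<beta> N J h) \<inter> {\<sigma>. \<sigma> [] = s} \<noteq> {}"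
proof -
  let ?C = "configs (vertices N h)"
  let ?\<sigma> = "restrict (\<lambda>_. s) (vertices N h)"
  have C: "?\<sigma> \<in> ?C" using assms by (auto simp: configs_def)
  have "(\<Sum>\<tau>\<in>?C. gibbs_weight \<beta> N J h \<tau>) > 0"
    using finite_configs[OF finite_vertices] configs_nonempty
    by (intro sum_pos) (auto simp: gibbs_weight_def)
  with C have "pmf (gibbs \<beta> N J h) ?\<sigma> > 0" by (simp add: pmf_gibbs gibbs_weight_def)
  then have "?\<sigma> \<in> set_pmf (gibbs \<beta> N J h)" by (simp add: set_pmf_iff)
  moreover have "?\<sigma> [] = s" by (simp add: vertices_def gw_tree.root)
  ultimately show ?thesis by blast
qed

text \<open>
  The law of the spins at distance \<open>h\<close> from the root, given that the root has spin \<open>s\<close>.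
  If there is no such vertex, this is the point mass at the empty configuration for either
  value of \<open>s\<close>, so that the total variation distance between the two laws is \<open>0\<close>.
\<close>

definition level_law ::
  "real \<Rightarrow> (nat list \<Rightarrow> nat) \<Rightarrow> (nat list \<Rightarrow> real) \<Rightarrow> nat \<Rightarrow> int \<Rightarrow> (nat list \<Rightarrow> int) pmf" where
  "level_law \<beta> N J h s =
     map_pmf (\<lambda>\<sigma>. restrict \<sigma> (level N h)) (cond_pmf (gibbs \<beta> N J h) {\<sigma>. \<sigma> [] = s})"

definition tv_dist :: "'a pmf \<Rightarrow> 'a pmf \<Rightarrow> real" where
  "tv_dist p q = (SUP A. \<bar>measure_pmf.prob p A - measure_pmf.prob q A\<bar>)"

definition expected_tv :: "real \<Rightarrow> real measure \<Rightarrow> nat pmf \<Rightarrow> nat \<Rightarrow> real" where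
  "expected_tv \<beta> \<phi> \<zeta> h =
     (\<integral>N. (\<integral>J. tv_dist (level_law \<beta> N J h 1) (level_law \<beta> N J h (- 1))
            \<partial>(\<Pi>\<^sub>M v\<in>edges N h. \<phi>))
      \<partial>(\<Pi>\<^sub>M v\<in>(UNIV :: nat list set). measure_pmf \<zeta>))"

definition reconstruction :: "real \<Rightarrow> real measure \<Rightarrow> nat pmf \<Rightarrow> bool" where
  "reconstruction \<beta> \<phi> \<zeta> \<longleftrightarrow> limsup (\<lambda>h. ereal (expected_tv \<beta> \<phi> \<zeta> h)) > 0"

definition non_reconstruction :: "real \<Rightarrow> real measure \<Rightarrow> nat pmf \<Rightarrow> bool" where
  "non_reconstruction \<beta> \<phi> \<zeta> \<longleftrightarrow> expected_tv \<beta> \<phi> \<zeta> \<longlonglongrightarrow> 0"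

text \<open>
  Extended-real valued, so that the threshold is \<open>\<infinity>\<close> when the expectation
  vanishes, that is, when the coupling is almost surely \<open>0\<close>.
\<close>

definition KS_threshold :: "real \<Rightarrow> real measure \<Rightarrow> ereal" where
  "KS_threshold \<beta> \<phi> =
     inverse (ereal (\<integral>x. ((1 - exp (\<beta> * x)) / (1 + exp (\<beta> * x)))\<^sup>2 \<partial>\<phi>))"

end

theory Submission
  imports Defs
begin

text \<open>
  Put \<open>\<theta> = (e\<^bsup>\<beta>J\<^esup> - 1) / (e\<^bsup>\<beta>J\<^esup> + 1)\<close>. Given the spin of the root, the spins propagate down the
  tree as a Markov chain whose transition across an edge is a binary symmetric channel with
  correlation \<open>\<theta>\<close>. Let \<open>W\<^sub>h\<close> be the sum over the vertices at level \<open>h\<close> of the product of \<open>\<theta>\<^sup>2\<close> along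
  the path to the root. Its mean is \<open>a\<^sup>h\<close> with \<open>a = d E \<theta>\<^sup>2\<close>, and the threshold is \<open>a = 1\<close>.

  If \<open>a < 1\<close>: the squared Hellinger distance between the two laws at level \<open>h\<close> is subadditive over
  the subtrees of the root and contracts by \<open>\<theta>\<^sup>2\<close> through an edge, so it is at most \<open>W\<^sub>h\<close>. It controls
  the total variation distance, whose mean therefore tends to \<open>0\<close>.

  If \<open>a > 1\<close>: the spins at level \<open>h\<close>, weighted by the product of \<open>\<theta>\<close> along their paths, sum to a
  statistic \<open>S\<close> with conditional means \<open>W\<^sub>h\<close> and \<open>- W\<^sub>h\<close>. The finite second moment of the offspring law
  gives \<open>E S\<^sup>2 \<le> C a\<^bsup>2h\<^esup>\<close>, and by Cauchy--Schwarz the mean total variation distance is at least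
  \<open>1 / C\<close> at every level. Cauchy--Schwarz is used in the form \<open>2xy \<le> l x\<^sup>2 + y\<^sup>2 / l\<close>, which survives
  integration over the couplings and then over the tree.
\<close>

section \<open>Trees and configurations seen from the root\<close>

text \<open>The labelling as seen from child \<open>i\<close> of the root: words of the subtree are
  reindexed so that the child becomes \<open>[]\<close>. Every recursion below peels off the root
  and passes to \<open>below i\<close>.\<close>

abbreviation (input) below :: "nat \<Rightarrow> (nat list \<Rightarrow> 'a) \<Rightarrow> nat list \<Rightarrow> 'a" where
  "below i f \<equiv> (\<lambda>v. f (i # v))"

lemma gw_tree_snoc: "v @ [j] \<in> gw_tree N \<longleftrightarrow> v \<in> gw_tree N \<and> j < N v"
  by (auto elim: gw_tree.cases intro: gw_tree.intros)

text \<open>\<open>gw_tree\<close> grows words at the end, while the recursions split them at the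
  front. Both sides satisfy the same rule for appending a letter, so reverse induction links the two
  views.\<close>

lemma gw_tree_Cons: "i # v \<in> gw_tree N \<longleftrightarrow> i < N [] \<and> v \<in> gw_tree (below i N)"
proof (induction v rule: rev_induct)
  case Nil
  show ?case using gw_tree_snoc[of "[]" i N] by (simp add: gw_tree.root)
next
  case (snoc j v)
  then show ?case
    using gw_tree_snoc[of "i # v" j N] gw_tree_snoc[of v j "below i N"] by simp
qed

lemma level_0: "level N 0 = {[]}"
  by (auto simp: level_def gw_tree.root)

lemma vertices_0: "vertices N 0 = {[]}"
  by (auto simp: vertices_def gw_tree.root)

lemma edges_0: "edges N 0 = {}"
  by (simp add: edges_def vertices_0)

lemma Nil_in_vertices: "[] \<in> vertices N h"
  by (simp add: vertices_def gw_tree.root)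

lemma Cons_in_vertices_Suc:
  "i # v \<in> vertices N (Suc h) \<longleftrightarrow> i < N [] \<and> v \<in> vertices (below i N) h"
  by (auto simp: vertices_def gw_tree_Cons)

lemma edges_Suc: "edges N (Suc h) = (\<Union>i<N []. (#) i ` vertices (below i N) h)"
proof (intro set_eqI)
  show "v \<in> edges N (Suc h) \<longleftrightarrow> v \<in> (\<Union>i<N []. (#) i ` vertices (below i N) h)" for v
    by (cases v) (auto simp: edges_def Cons_in_vertices_Suc)
qed

lemma vertices_eq_insert_edges: "vertices N h = insert [] (edges N h)"
  using Nil_in_vertices by (auto simp: edges_def)

lemma level_Suc_root: "level N (Suc h) = (\<Union>i<N []. (#) i ` level (below i N) h)"
proof (intro set_eqI)
  show "v \<in> level N (Suc h) \<longleftrightarrow> v \<in> (\<Union>i<N []. (#) i ` level (below i N) h)" for v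
    by (cases v) (auto simp: level_def gw_tree_Cons)
qed

lemma level_subset_vertices: "level N h \<subseteq> vertices N h"
  by (auto simp: level_def vertices_def)

lemma finite_edges: "finite (edges N h)"
  by (simp add: edges_def finite_vertices)

lemma sum_edges_Suc:
  "(\<Sum>v\<in>edges N (Suc h). f v) = (\<Sum>i<N []. f [i] + (\<Sum>v\<in>edges (below i N) h. f (i # v)))"
proof -
  have "(\<Sum>v\<in>edges N (Suc h). f v) = (\<Sum>i<N []. \<Sum>v\<in>(#) i ` vertices (below i N) h. f v)"
    unfolding edges_Suc by (rule sum.UNION_disjoint) (auto simp: finite_vertices)
  also have "\<dots> = (\<Sum>i<N []. \<Sum>v\<in>vertices (below i N) h. f (i # v))"
    by (simp add: sum.reindex)
  also have "\<dots> = (\<Sum>i<N []. f [i] + (\<Sum>v\<in>edges (below i N) h. f (i # v)))"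
    proof (intro sum.cong refl)
    fix i
    have "[] \<notin> edges (below i N) h" by (simp add: edges_def)
    then show "(\<Sum>v\<in>vertices (below i N) h. f (i # v)) = f [i] + (\<Sum>v\<in>edges (below i N) h. f (i # v))"
      by (simp add: vertices_eq_insert_edges finite_edges)
  qed
  finally show ?thesis .
qed

lemma gibbs_weight_Suc:
  "gibbs_weight \<beta> N J (Suc h) \<sigma> = (\<Prod>i<N []. exp (\<beta> * (of_bool (\<sigma> [] = \<sigma> [i]) * J [i])) *
      gibbs_weight \<beta> (below i N) (below i J) h (below i \<sigma>))"
proof -
  have "(\<Sum>v\<in>edges (below i N) h. of_bool (\<sigma> (butlast (i # v)) = \<sigma> (i # v)) * J (i # v)) =
        (\<Sum>v\<in>edges (below i N) h. of_bool (\<sigma> (i # butlast v) = \<sigma> (i # v)) * J (i # v))" for i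
    by (intro sum.cong) (auto simp: edges_def)
  then show ?thesis
    unfolding gibbs_weight_def sum_edges_Suc
    by (simp add: distrib_left exp_add exp_sum sum_distrib_left)
qed

text \<open>Distributivity: a configuration on the disjoint union of the blocks is a tuple of
  configurations, one per block, obtained by splitting words at the first letter. The congruence
  hypothesis is there because \<open>below i x\<close> need not be \<open>undefined\<close> off
  \<open>V i\<close>, whereas members of \<open>configs (V i)\<close> are.\<close>

lemma sum_configs_UN:
  fixes f :: "nat \<Rightarrow> (nat list \<Rightarrow> int) \<Rightarrow> real"
  assumes fin: "\<And>i. i < n \<Longrightarrow> finite (V i)"
    and cong: "\<And>i y y'. i < n \<Longrightarrow> (\<And>v. v \<in> V i \<Longrightarrow> y v = y' v) \<Longrightarrow> f i y = f i y'"
  shows "(\<Sum>x\<in>configs (\<Union>i<n. (#) i ` V i). \<Prod>i<n. f i (below i x)) =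
         (\<Prod>i<n. \<Sum>y\<in>configs (V i). f i y)"
proof -
  let ?U = "\<Union>i<n. (#) i ` V i"
  have "(\<Prod>i<n. \<Sum>y\<in>configs (V i). f i y) =
        (\<Sum>g\<in>PiE {..<n} (\<lambda>i. configs (V i)). \<Prod>i<n. f i (g i))"
    by (rule prod_sum_PiE) (auto intro: finite_configs fin)
  also have "\<dots> = (\<Sum>x\<in>configs ?U. \<Prod>i<n. f i (below i x))"
  proof (rule sum.reindex_bij_witness
      [where i = "\<lambda>x. \<lambda>i\<in>{..<n}. restrict (below i x) (V i)"
         and j = "\<lambda>g. \<lambda>v\<in>?U. g (hd v) (tl v)"])
    fix g assume g: "g \<in> PiE {..<n} (\<lambda>i. configs (V i))"
    have gi: "g i v \<in> {-1, 1}" if "i < n" "v \<in> V i" for i v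
      using g that by (auto simp: configs_def PiE_iff)
    show "(\<lambda>i\<in>{..<n}. restrict (below i (\<lambda>v\<in>?U. g (hd v) (tl v))) (V i)) = g"
    proof
      fix i
      show "(\<lambda>i\<in>{..<n}. restrict (below i (\<lambda>v\<in>?U. g (hd v) (tl v))) (V i)) i = g i"
      proof (cases "i < n")
        case True
        have "restrict (below i (\<lambda>v\<in>?U. g (hd v) (tl v))) (V i) v = g i v" for v
          using g True by (cases "v \<in> V i") (auto simp: configs_def PiE_iff extensional_def)
        then show ?thesis using True by auto
      qed (use g in \<open>auto simp: PiE_iff extensional_def\<close>)
    qed
    show "(\<lambda>v\<in>?U. g (hd v) (tl v)) \<in> configs ?U"
      unfolding configs_def using gi by (intro restrict_PiE_iff[THEN iffD2]) auto
    show "(\<Prod>i<n. f i (below i (\<lambda>v\<in>?U. g (hd v) (tl v)))) = (\<Prod>i<n. f i (g i))"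
      by (intro prod.cong refl cong) auto
  next
    fix x assume x: "x \<in> configs ?U"
    show "(\<lambda>v\<in>?U. (\<lambda>i\<in>{..<n}. restrict (below i x) (V i)) (hd v) (tl v)) = x"
    proof
      fix v
      show "(\<lambda>v\<in>?U. (\<lambda>i\<in>{..<n}. restrict (below i x) (V i)) (hd v) (tl v)) v = x v"
        using x by (cases "v \<in> ?U") (auto simp: configs_def PiE_iff extensional_def)
    qed
    have "x (i # v) \<in> {-1, 1}" if "i < n" "v \<in> V i" for i v
    proof -
      have "i # v \<in> ?U" using that by auto
      with x show ?thesis unfolding configs_def by (rule PiE_mem)
    qed
    then show "(\<lambda>i\<in>{..<n}. restrict (below i x) (V i)) \<in> PiE {..<n} (\<lambda>i. configs (V i))"
      unfolding configs_def by (auto simp: PiE_iff extensional_def)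
  qed
  finally show ?thesis ..
qed

lemma sum_configs_insert_root:
  fixes F :: "(nat list \<Rightarrow> int) \<Rightarrow> real"
  assumes "finite V" "[] \<notin> V" "s \<in> {-1, 1}"
  shows "(\<Sum>\<sigma>\<in>configs (insert [] V). of_bool (\<sigma> [] = s) * F \<sigma>) =
         (\<Sum>\<tau>\<in>configs V. F (\<tau>([] := s)))"
proof -
  have "(\<Sum>\<sigma>\<in>configs (insert [] V). of_bool (\<sigma> [] = s) * F \<sigma>) =
        (\<Sum>\<sigma>\<in>{\<sigma>\<in>configs (insert [] V). \<sigma> [] = s}. F \<sigma>)"
    using finite_configs[of "insert [] V"] assms(1)
    by (intro sum.mono_neutral_cong_right) auto
  \<comment> \<open>Configurations are extensional, so forgetting the root spin means resetting it
    to \<open>undefined\<close>.\<close>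
  also have "\<dots> = (\<Sum>\<tau>\<in>configs V. F (\<tau>([] := s)))"
    using assms(2,3)
    by (intro sum.reindex_bij_witness[where i = "\<lambda>\<tau>. \<tau>([] := s)" and j = "\<lambda>\<sigma>. \<sigma>([] := undefined)"])
       (auto simp: configs_def PiE_iff extensional_def fun_upd_idem)
  finally show ?thesis .
qed

section \<open>The law of the spins at a level\<close>

text \<open>This is tanh(\<beta>x/2), the \<theta> of the overview; its square is the integrand of
  \<open>KS_threshold\<close>.\<close>

definition edge_corr :: "real \<Rightarrow> real \<Rightarrow> real" where
  "edge_corr \<beta> x = (exp (\<beta> * x) - 1) / (exp (\<beta> * x) + 1)"

text \<open>The transition probability from a vertex of spin \<open>s\<close> to a child of spin
  \<open>t\<close>: the two Gibbs weights of an edge are \<open>exp (\<beta> * x)\<close> and 1,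
  whence the denominator.\<close>

definition spin_kernel :: "real \<Rightarrow> real \<Rightarrow> int \<Rightarrow> int \<Rightarrow> real" where
  "spin_kernel \<beta> x s t = exp (\<beta> * (of_bool (s = t) * x)) / (1 + exp (\<beta> * x))"

lemma one_plus_exp_pos: "0 < 1 + exp (x :: real)"
  by (simp add: add_pos_pos)

lemma spin_kernel_pos: "0 < spin_kernel \<beta> x s t"
  by (simp add: spin_kernel_def one_plus_exp_pos)

lemma spin_kernel_eq:
  assumes "s \<in> {-1, 1}" "t \<in> {-1, 1}"
  shows "spin_kernel \<beta> x s t = (1 + of_int s * of_int t * edge_corr \<beta> x) / 2"
proof -
  have "exp (\<beta> * x) + 1 \<noteq> 0" using one_plus_exp_pos[of "\<beta> * x"] by simp
  then show ?thesis
    using assms by (auto simp: spin_kernel_def edge_corr_def field_simps)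
qed

lemma edge_corr_sq_le_1: "(edge_corr \<beta> x)\<^sup>2 \<le> 1"
proof -
  have "\<bar>edge_corr \<beta> x\<bar> \<le> 1"
    using one_plus_exp_pos[of "\<beta> * x"] by (simp add: edge_corr_def abs_le_iff field_simps)
  then show ?thesis by (simp add: abs_square_le_1)
qed

text \<open>The broadcast description of the law at level \<open>h\<close>: each child draws its
  spin through the channel of its edge, and the subtrees then evolve independently. A childless root
  yields the empty product 1, the mass of the empty configuration.\<close>

primrec level_prob ::
  "real \<Rightarrow> nat \<Rightarrow> (nat list \<Rightarrow> nat) \<Rightarrow> (nat list \<Rightarrow> real) \<Rightarrow> int \<Rightarrow> (nat list \<Rightarrow> int) \<Rightarrow> real" where
  "level_prob \<beta> 0 N J s x = of_bool (x [] = s)"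
| "level_prob \<beta> (Suc h) N J s x = (\<Prod>i<N []. \<Sum>t\<in>{-1, 1}. spin_kernel \<beta> (J [i]) s t *
      level_prob \<beta> h (below i N) (below i J) t (below i x))"

definition child_prob ::
  "real \<Rightarrow> nat \<Rightarrow> (nat list \<Rightarrow> nat) \<Rightarrow> (nat list \<Rightarrow> real) \<Rightarrow> int \<Rightarrow> nat \<Rightarrow> (nat list \<Rightarrow> int) \<Rightarrow> real" where
  "child_prob \<beta> h N J s i y =
     (\<Sum>t\<in>{-1, 1}. spin_kernel \<beta> (J [i]) s t * level_prob \<beta> h (below i N) (below i J) t y)"

lemma level_prob_Suc:
  "level_prob \<beta> (Suc h) N J s x = (\<Prod>i<N []. child_prob \<beta> h N J s i (below i x))"
  by (simp add: child_prob_def)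

declare level_prob.simps(2) [simp del]

lemma level_prob_cong:
  "(\<And>v. v \<in> level N h \<Longrightarrow> x v = y v) \<Longrightarrow> level_prob \<beta> h N J s x = level_prob \<beta> h N J s y"
proof (induction h arbitrary: N J s x y)
  case 0
  then show ?case by (simp add: level_0)
next
  case (Suc h)
  have "child_prob \<beta> h N J s i (below i x) = child_prob \<beta> h N J s i (below i y)" if "i < N []" for i
  proof -
    have "level_prob \<beta> h (below i N) (below i J) t (below i x) =
          level_prob \<beta> h (below i N) (below i J) t (below i y)" for t
      using that by (intro Suc.IH Suc.prems) (auto simp: level_Suc_root)
    then show ?thesis by (simp add: child_prob_def)
  qed
  then show ?case by (simp add: level_prob_Suc)
qed

lemma child_prob_cong:
  "(\<And>v. v \<in> level (below i N) h \<Longrightarrow> x v = y v) \<Longrightarrow> child_prob \<beta> h N J s i x = child_prob \<beta> h N J s i y"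
  unfolding child_prob_def using level_prob_cong[of "below i N" h x y] by simp

lemma level_prob_nonneg: "0 \<le> level_prob \<beta> h N J s x"
proof (induction h arbitrary: N J s x)
  case (Suc h)
  then show ?case
    unfolding level_prob.simps
    by (intro prod_nonneg sum_nonneg mult_nonneg_nonneg ballI less_imp_le[OF spin_kernel_pos])
qed simp

lemma child_prob_nonneg: "0 \<le> child_prob \<beta> h N J s i x"
  unfolding child_prob_def
  by (intro sum_nonneg mult_nonneg_nonneg level_prob_nonneg less_imp_le[OF spin_kernel_pos])

lemma sum_configs_level_Suc:
  fixes f :: "nat \<Rightarrow> (nat list \<Rightarrow> int) \<Rightarrow> real"
  assumes "\<And>i y y'. i < N [] \<Longrightarrow> (\<And>v. v \<in> level (below i N) h \<Longrightarrow> y v = y' v) \<Longrightarrow> f i y = f i y'"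
  shows "(\<Sum>x\<in>configs (level N (Suc h)). \<Prod>i<N []. f i (below i x)) =
         (\<Prod>i<N []. \<Sum>y\<in>configs (level (below i N) h). f i y)"
  unfolding level_Suc_root by (rule sum_configs_UN) (rule finite_level, rule assms)

lemma finite_configs_level: "finite (configs (level N h))"
  by (simp add: finite_configs finite_level)

lemma configs_root: "configs {[]} = {(\<lambda>_. undefined)([] := -1), (\<lambda>_. undefined)([] := 1)}"
proof (intro set_eqI iffI)
  fix x assume "x \<in> configs {[]}"
  then have "x = (\<lambda>_. undefined)([] := x [])" "x [] = -1 \<or> x [] = 1"
    by (auto simp: configs_def PiE_iff extensional_def fun_eq_iff)
  then show "x \<in> {(\<lambda>_. undefined)([] := -1), (\<lambda>_. undefined)([] := 1)}" by (metis insertCI)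
qed (auto simp: configs_def PiE_iff extensional_def)

lemma sum_configs_root:
  fixes F :: "(nat list \<Rightarrow> int) \<Rightarrow> real"
  shows "(\<Sum>x\<in>configs {[]}. F x) = F ((\<lambda>_. undefined)([] := -1)) + F ((\<lambda>_. undefined)([] := 1))"
proof -
  have "((\<lambda>_. undefined)([] := -1) :: nat list \<Rightarrow> int) \<noteq> (\<lambda>_. undefined)([] := 1)"
    by (metis fun_upd_same one_neq_neg_one)
  then show ?thesis by (simp add: configs_root)
qed

lemma sum_child_prob:
  "(\<Sum>y\<in>configs (level (below i N) h). child_prob \<beta> h N J s i y * f y) =
   (\<Sum>t\<in>{-1, 1}. spin_kernel \<beta> (J [i]) s t *
      (\<Sum>y\<in>configs (level (below i N) h). level_prob \<beta> h (below i N) (below i J) t y * f y))"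
  by (simp add: child_prob_def distrib_right sum.distrib sum_distrib_left mult.assoc)

lemma sum_spin_kernel:
  assumes "s \<in> {-1, 1}"
  shows "(\<Sum>t\<in>{-1, 1}. spin_kernel \<beta> x s t) = 1"
  using assms by (auto simp: spin_kernel_eq field_simps)

lemma sum_level_prob: "s \<in> {-1, 1} \<Longrightarrow> (\<Sum>x\<in>configs (level N h). level_prob \<beta> h N J s x) = 1"
proof (induction h arbitrary: N J s)
  case 0
  then show ?case by (auto simp: level_0 sum_configs_root)
next
  case (Suc h)
  have "(\<Sum>y\<in>configs (level (below i N) h). child_prob \<beta> h N J s i y) = 1" for i
    using sum_child_prob[of \<beta> h N J s i "\<lambda>_. 1"] Suc.IH[of "-1"] Suc.IH[of 1]
      sum_spin_kernel[OF Suc.prems, of \<beta> "J [i]"] by simp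
  then show ?case
    unfolding level_prob_Suc by (subst sum_configs_level_Suc) (auto intro: child_prob_cong)
qed

lemma sum_child_prob_1:
  assumes "s \<in> {-1, 1}"
  shows "(\<Sum>y\<in>configs (level (below i N) h). child_prob \<beta> h N J s i y) = 1"
  using sum_child_prob[of \<beta> h N J s i "\<lambda>_. 1"] sum_level_prob[of "-1"] sum_level_prob[of 1]
      sum_spin_kernel[OF assms, of \<beta> "J [i]"] by simp

section \<open>The Gibbs measure as a broadcast process\<close>

lemma gibbs_weight_cong:
  assumes "\<And>v. v \<in> vertices N h \<Longrightarrow> \<sigma> v = \<tau> v"
  shows "gibbs_weight \<beta> N J h \<sigma> = gibbs_weight \<beta> N J h \<tau>"
proof -
  have "butlast v \<in> vertices N h" if "v \<in> edges N h" for v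
  proof -
    from that have v: "v \<in> gw_tree N" "length v \<le> h" "v \<noteq> []"
      by (auto simp: edges_def vertices_def)
    then show ?thesis using gw_tree_snoc[of "butlast v" "last v" N] by (simp add: vertices_def)
  qed
  then have "(\<Sum>v\<in>edges N h. of_bool (\<sigma> (butlast v) = \<sigma> v) * J v) =
      (\<Sum>v\<in>edges N h. of_bool (\<tau> (butlast v) = \<tau> v) * J v)"
    using assms by (intro sum.cong) (auto simp: edges_def)
  then show ?thesis by (simp add: gibbs_weight_def)
qed

text \<open>The partition function restricted to a fixed root spin. It is a product over edges and
  takes the same value for both spins, which is why the chain can be read off without any correction
  at the vertices.\<close>

primrec partition_const :: "real \<Rightarrow> nat \<Rightarrow> (nat list \<Rightarrow> nat) \<Rightarrow> (nat list \<Rightarrow> real) \<Rightarrow> real" where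
  "partition_const \<beta> 0 N J = 1"
| "partition_const \<beta> (Suc h) N J =
     (\<Prod>i<N []. (1 + exp (\<beta> * J [i])) * partition_const \<beta> h (below i N) (below i J))"

text \<open>Once the root spin is fixed, both the boundary constraint and the weight factor over the
  child subtrees. Summing out the interior spins turns each edge weight into
  \<open>spin_kernel\<close> times the factor \<open>1 + exp (\<beta> * J [i])\<close>, which goes
  into \<open>partition_const\<close>.\<close>

lemma sum_gibbs_weight_boundary:
  "s \<in> {-1, 1} \<Longrightarrow>
   (\<Sum>\<sigma>\<in>configs (vertices N h). of_bool (\<sigma> [] = s) *
      (of_bool (\<forall>v\<in>level N h. \<sigma> v = x v) * gibbs_weight \<beta> N J h \<sigma>)) =
   partition_const \<beta> h N J * level_prob \<beta> h N J s x"
proof (induction h arbitrary: N J s x)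
  case 0
  then show ?case
    by (auto simp: level_0 vertices_0 sum_configs_root gibbs_weight_def edges_0)
next
  case (Suc h)
  define g where "g i y = of_bool (\<forall>v\<in>level (below i N) h. y v = x (i # v)) *
      gibbs_weight \<beta> (below i N) (below i J) h y" for i y
  have g_cong: "g i y = g i y'" if "\<And>v. v \<in> vertices (below i N) h \<Longrightarrow> y v = y' v" for i y y'
    using gibbs_weight_cong[OF that] that level_subset_vertices[of "below i N" h]
    by (auto simp: g_def subset_iff)
  have "(\<Sum>\<sigma>\<in>configs (vertices N (Suc h)). of_bool (\<sigma> [] = s) *
      (of_bool (\<forall>v\<in>level N (Suc h). \<sigma> v = x v) * gibbs_weight \<beta> N J (Suc h) \<sigma>)) =
    (\<Sum>\<tau>\<in>configs (edges N (Suc h)). of_bool (\<forall>v\<in>level N (Suc h). (\<tau>([] := s)) v = x v) *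
        gibbs_weight \<beta> N J (Suc h) (\<tau>([] := s)))"
    unfolding vertices_eq_insert_edges
    by (rule sum_configs_insert_root) (use Suc.prems in \<open>auto simp: finite_vertices edges_def\<close>)
  also have "\<dots> = (\<Sum>\<tau>\<in>configs (edges N (Suc h)). \<Prod>i<N [].
      exp (\<beta> * (of_bool (s = \<tau> [i]) * J [i])) * g i (below i \<tau>))"
  proof (intro sum.cong refl)
    fix \<tau> :: "nat list \<Rightarrow> int"
    have "of_bool (\<forall>v\<in>level N (Suc h). (\<tau>([] := s)) v = x v) =
        (\<Prod>i<N []. of_bool (\<forall>v\<in>level (below i N) h. \<tau> (i # v) = x (i # v)) :: real)"
      by (auto simp: level_Suc_root)
    then show "of_bool (\<forall>v\<in>level N (Suc h). (\<tau>([] := s)) v = x v) *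
        gibbs_weight \<beta> N J (Suc h) (\<tau>([] := s)) =
        (\<Prod>i<N []. exp (\<beta> * (of_bool (s = \<tau> [i]) * J [i])) * g i (below i \<tau>))"
      by (simp add: gibbs_weight_Suc g_def prod.distrib)
  qed
  also have "\<dots> = (\<Prod>i<N []. \<Sum>y\<in>configs (vertices (below i N) h).
      exp (\<beta> * (of_bool (s = y []) * J [i])) * g i y)"
    unfolding edges_Suc
  proof (rule sum_configs_UN[where f = "\<lambda>i y. exp (\<beta> * (of_bool (s = y []) * J [i])) * g i y"])
    show "exp (\<beta> * (of_bool (s = y []) * J [i])) * g i y =
        exp (\<beta> * (of_bool (s = y' []) * J [i])) * g i y'"
      if "\<And>v. v \<in> vertices (below i N) h \<Longrightarrow> y v = y' v" for i y y'
      using g_cong[OF that] that[OF Nil_in_vertices] by simp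
  qed (rule finite_vertices)
  also have "\<dots> = (\<Prod>i<N []. ((1 + exp (\<beta> * J [i])) * partition_const \<beta> h (below i N) (below i J)) *
      child_prob \<beta> h N J s i (below i x))"
  proof (intro prod.cong refl)
    fix i
    let ?C = "configs (vertices (below i N) h)"
    have root: "y [] \<in> {-1, 1}" if "y \<in> ?C" for y
      using that Nil_in_vertices[of "below i N" h] by (auto simp: configs_def PiE_iff)
    \<comment> \<open>The sum is split according to the spin \<open>t\<close> of the child, so that
      the induction hypothesis applies with root spin \<open>t\<close>.\<close>
    have "(\<Sum>y\<in>?C. exp (\<beta> * (of_bool (s = y []) * J [i])) * g i y) =
          (\<Sum>y\<in>?C. \<Sum>t\<in>{-1, 1}. exp (\<beta> * (of_bool (s = t) * J [i])) * (of_bool (y [] = t) * g i y))"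
      by (intro sum.cong refl) (use root in force)
    also have "\<dots> = (\<Sum>t\<in>{-1, 1}. exp (\<beta> * (of_bool (s = t) * J [i])) *
        (\<Sum>y\<in>?C. of_bool (y [] = t) * g i y))"
      by (subst sum.swap) (simp only: sum_distrib_left)
    also have "\<dots> = (\<Sum>t\<in>{-1, 1}. exp (\<beta> * (of_bool (s = t) * J [i])) *
        (partition_const \<beta> h (below i N) (below i J) *
         level_prob \<beta> h (below i N) (below i J) t (below i x)))"
      by (intro sum.cong refl) (simp only: g_def Suc.IH)
    also have "\<dots> = ((1 + exp (\<beta> * J [i])) * partition_const \<beta> h (below i N) (below i J)) *
      child_prob \<beta> h N J s i (below i x)"
      using one_plus_exp_pos[of "\<beta> * J [i]"]
      unfolding child_prob_def sum_distrib_left spin_kernel_def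
      by (intro sum.cong refl) (simp add: field_simps)
    finally show "(\<Sum>y\<in>?C. exp (\<beta> * (of_bool (s = y []) * J [i])) * g i y) = \<dots>" .
  qed
  finally show ?case by (simp add: level_prob_Suc prod.distrib)
qed

text \<open>By \<open>sum_gibbs_weight_boundary\<close> the law is proportional to
  \<open>level_prob\<close>. Both have total mass 1 on the configurations of the level, so the
  constant \<open>c\<close> is 1 and the probability of the root spin never has to be
  computed.\<close>

lemma pmf_level_law:
  assumes s: "s \<in> {-1, 1}"
  shows "pmf (level_law \<beta> N J h s) x =
    (if x \<in> configs (level N h) then level_prob \<beta> h N J s x else 0)"
proof -
  let ?C = "configs (vertices N h)" and ?L = "configs (level N h)"
  let ?g = "gibbs \<beta> N J h" and ?w = "gibbs_weight \<beta> N J h"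
  define Z where "Z = (\<Sum>\<tau>\<in>?C. ?w \<tau>)"
  define c where "c = partition_const \<beta> h N J / Z / measure ?g {\<sigma>. \<sigma> [] = s}"
  have fin: "finite ?C" by (simp add: finite_configs finite_vertices)
  have supp: "set_pmf ?g \<subseteq> ?C" by (auto simp: set_pmf_iff pmf_gibbs split: if_splits)
  have "restrict \<sigma> (level N h) \<in> ?L" if "\<sigma> \<in> ?C" for \<sigma>
    using that level_subset_vertices[of N h] by (auto simp: configs_def PiE_iff subset_iff)
  then have supp_law: "set_pmf (level_law \<beta> N J h s) \<subseteq> ?L"
    using supp by (auto simp: level_law_def set_cond_pmf[OF gibbs_root_possible[OF s]])
  have proportional: "pmf (level_law \<beta> N J h s) x = c * level_prob \<beta> h N J s x" if x: "x \<in> ?L" for x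
  proof -
    let ?R = "(\<lambda>\<sigma>. restrict \<sigma> (level N h)) -` {x}"
    have R: "?R = {\<sigma>. \<forall>v\<in>level N h. \<sigma> v = x v}"
      using x by (auto simp: configs_def PiE_iff extensional_def fun_eq_iff)
    have "pmf (level_law \<beta> N J h s) x = measure (cond_pmf ?g {\<sigma>. \<sigma> [] = s}) ?R"
      by (simp add: level_law_def pmf_map)
    also have "\<dots> = measure ?g ({\<sigma>. \<sigma> [] = s} \<inter> ?R) / measure ?g {\<sigma>. \<sigma> [] = s}"
      unfolding cond_pmf.rep_eq[OF gibbs_root_possible[OF s]]
      by (rule measure_uniform_measure)
         (use measure_pmf_zero_iff[of ?g "{\<sigma>. \<sigma> [] = s}"] gibbs_root_possible[OF s, of \<beta> N J h] in
           \<open>auto simp: measure_pmf.emeasure_eq_measure\<close>)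
    also have "measure ?g ({\<sigma>. \<sigma> [] = s} \<inter> ?R) = measure ?g (?C \<inter> ({\<sigma>. \<sigma> [] = s} \<inter> ?R))"
      by (intro measure_eq_AE) (use supp in \<open>auto simp: AE_measure_pmf_iff\<close>)
    also have "\<dots> = (\<Sum>\<sigma>\<in>?C \<inter> ({\<sigma>. \<sigma> [] = s} \<inter> ?R). pmf ?g \<sigma>)"
      using fin by (simp add: measure_measure_pmf_finite)
    also have "\<dots> = (\<Sum>\<sigma>\<in>?C. of_bool (\<sigma> [] = s) *
      (of_bool (\<forall>v\<in>level N h. \<sigma> v = x v) * ?w \<sigma>) / Z)"
      unfolding R using fin by (intro sum.mono_neutral_cong_left) (auto simp: pmf_gibbs Z_def)
    also have "\<dots> = partition_const \<beta> h N J * level_prob \<beta> h N J s x / Z"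
      by (simp only: sum_gibbs_weight_boundary[OF s] flip: sum_divide_distrib)
    finally show ?thesis by (simp add: c_def)
  qed
  have "1 = (\<Sum>x\<in>?L. pmf (level_law \<beta> N J h s) x)"
    using supp_law by (simp add: sum_pmf_eq_1 finite_configs_level)
  also have "\<dots> = c * (\<Sum>x\<in>?L. level_prob \<beta> h N J s x)"
    by (simp add: proportional sum_distrib_left)
  finally have "c = 1" by (simp add: sum_level_prob[OF s])
  with proportional supp_law show ?thesis by (auto simp: set_pmf_iff)
qed

section \<open>Total variation on a fixed tree\<close>

text \<open>The supremum is attained on the set where the first mass dominates the second.\<close>

lemma tv_dist_eq_half_sum:
  assumes fin: "finite C" and p: "set_pmf p \<subseteq> C" and q: "set_pmf q \<subseteq> C"
  shows "tv_dist p q = (\<Sum>x\<in>C. \<bar>pmf p x - pmf q x\<bar>) / 2"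
proof -
  let ?d = "\<lambda>x. pmf p x - pmf q x"
  let ?h = "(\<Sum>x\<in>C. \<bar>?d x\<bar>) / 2"
  have prob_eq: "measure_pmf.prob r A = (\<Sum>x\<in>C \<inter> A. pmf r x)" if "set_pmf r \<subseteq> C" for r A
  proof -
    have "measure_pmf.prob r A = measure_pmf.prob r (C \<inter> A)"
      by (intro measure_eq_AE) (use that in \<open>auto simp: AE_measure_pmf_iff\<close>)
    then show ?thesis using fin by (simp add: measure_measure_pmf_finite)
  qed
  have diff: "measure_pmf.prob p A - measure_pmf.prob q A = (\<Sum>x\<in>C \<inter> A. ?d x)" for A
    by (simp add: prob_eq p q sum_subtractf)
  have split: "(\<Sum>x\<in>C. f x) = (\<Sum>x\<in>C \<inter> A. f x) + (\<Sum>x\<in>C - A. f x)" for f :: "'a \<Rightarrow> real" and A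
    using fin by (subst sum.Int_Diff[of C f A]) auto
  have total: "(\<Sum>x\<in>C. ?d x) = 0"
    using fin p q by (simp add: sum_subtractf sum_pmf_eq_1)
  have le: "\<bar>measure_pmf.prob p A - measure_pmf.prob q A\<bar> \<le> ?h" for A
  proof -
    \<comment> \<open>The differences have total 0, so an event and its complement carry opposite
      signed masses. The bound is the average of the two triangle inequalities.\<close>
    have "(\<Sum>x\<in>C \<inter> A. ?d x) = - (\<Sum>x\<in>C - A. ?d x)"
      using split[of ?d A] total by simp
    moreover have "\<bar>\<Sum>x\<in>C \<inter> A. ?d x\<bar> \<le> (\<Sum>x\<in>C \<inter> A. \<bar>?d x\<bar>)" by (rule sum_abs)
    moreover have "\<bar>\<Sum>x\<in>C - A. ?d x\<bar> \<le> (\<Sum>x\<in>C - A. \<bar>?d x\<bar>)" by (rule sum_abs)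
    moreover have "a \<le> (b + c) / 2" if "a \<le> b" "a \<le> c" for a b c :: real
      using that by simp
    ultimately show ?thesis using split[of "\<lambda>x. \<bar>?d x\<bar>" A] by (simp only: diff abs_minus_cancel)
  qed
  let ?A = "{x. ?d x \<ge> 0}"
  have "(\<Sum>x\<in>C \<inter> ?A. \<bar>?d x\<bar>) = (\<Sum>x\<in>C \<inter> ?A. ?d x)" by (intro sum.cong) auto
  moreover have "(\<Sum>x\<in>C - ?A. \<bar>?d x\<bar>) = - (\<Sum>x\<in>C - ?A. ?d x)"
    unfolding sum_negf[symmetric] by (intro sum.cong) auto
  ultimately have "?h = measure_pmf.prob p ?A - measure_pmf.prob q ?A"
    using split[of "\<lambda>x. \<bar>?d x\<bar>" ?A] split[of ?d ?A] total by (simp only: diff) simp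
  then have "?h \<le> \<bar>measure_pmf.prob p ?A - measure_pmf.prob q ?A\<bar>" by (simp only: abs_ge_self)
  also have "\<dots> \<le> tv_dist p q"
    unfolding tv_dist_def by (rule cSUP_upper[OF UNIV_I bdd_aboveI2[OF le]])
  finally show ?thesis
    unfolding tv_dist_def using le by (intro antisym cSUP_least) auto
qed

abbreviation level_tv :: "real \<Rightarrow> nat \<Rightarrow> (nat list \<Rightarrow> nat) \<Rightarrow> (nat list \<Rightarrow> real) \<Rightarrow> real" where
  "level_tv \<beta> h N J \<equiv> tv_dist (level_law \<beta> N J h 1) (level_law \<beta> N J h (- 1))"

lemma level_tv_eq:
  "level_tv \<beta> h N J =
     (\<Sum>x\<in>configs (level N h). \<bar>level_prob \<beta> h N J 1 x - level_prob \<beta> h N J (-1) x\<bar>) / 2"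
proof -
  have "set_pmf (level_law \<beta> N J h s) \<subseteq> configs (level N h)" if "s \<in> {-1, 1}" for s
    using that by (auto simp: set_pmf_iff pmf_level_law split: if_splits)
  then show ?thesis
    by (subst tv_dist_eq_half_sum[OF finite_configs_level]) (auto simp: pmf_level_law)
qed

section \<open>Upper bound through the Hellinger affinity\<close>

primrec level_energy :: "real \<Rightarrow> nat \<Rightarrow> (nat list \<Rightarrow> nat) \<Rightarrow> (nat list \<Rightarrow> real) \<Rightarrow> real" where
  "level_energy \<beta> 0 N J = 1"
| "level_energy \<beta> (Suc h) N J =
     (\<Sum>i<N []. (edge_corr \<beta> (J [i]))\<^sup>2 * level_energy \<beta> h (below i N) (below i J))"

lemma level_energy_nonneg: "0 \<le> level_energy \<beta> h N J"
  by (induction h arbitrary: N J) (auto intro!: sum_nonneg)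

text \<open>The Bhattacharyya coefficient of the two laws at level \<open>h\<close>; 1 minus it is
  the squared Hellinger distance.\<close>

definition affinity :: "real \<Rightarrow> nat \<Rightarrow> (nat list \<Rightarrow> nat) \<Rightarrow> (nat list \<Rightarrow> real) \<Rightarrow> real" where
  "affinity \<beta> h N J =
     (\<Sum>x\<in>configs (level N h). sqrt (level_prob \<beta> h N J 1 x * level_prob \<beta> h N J (-1) x))"

text \<open>
  The contraction of the squared Hellinger distance through a binary symmetric channel, in
  pointwise form: with \<open>A = (p + q) / 2\<close> and \<open>G = sqrt (p q)\<close> the product under the root is
  \<open>(1 - c\<^sup>2) A\<^sup>2 + c\<^sup>2 G\<^sup>2\<close>, so that the claim is convexity of the square.
\<close>

lemma sqrt_channel_ge:
  fixes p q c :: real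
  assumes "0 \<le> p" "0 \<le> q" "c\<^sup>2 \<le> 1"
  shows "(1 - c\<^sup>2) * ((p + q) / 2) + c\<^sup>2 * sqrt (p * q) \<le>
     sqrt (((1 - c) / 2 * q + (1 + c) / 2 * p) * ((1 + c) / 2 * q + (1 - c) / 2 * p))"
proof (rule real_le_rsqrt)
  define A where "A = (p + q) / 2"
  define G where "G = sqrt (p * q)"
  have G: "G\<^sup>2 = p * q" using assms by (simp add: G_def)
  have "((1 - c) / 2 * q + (1 + c) / 2 * p) * ((1 + c) / 2 * q + (1 - c) / 2 * p) =
      (1 - c\<^sup>2) * A\<^sup>2 + c\<^sup>2 * G\<^sup>2"
    unfolding G A_def by (simp add: field_simps power2_eq_square)
  also have "\<dots> = ((1 - c\<^sup>2) * A + c\<^sup>2 * G)\<^sup>2 + c\<^sup>2 * (1 - c\<^sup>2) * (A - G)\<^sup>2"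
    by (simp add: algebra_simps power2_eq_square)
  also have "\<dots> \<ge> ((1 - c\<^sup>2) * A + c\<^sup>2 * G)\<^sup>2" using assms(3) by simp
  finally show "((1 - c\<^sup>2) * ((p + q) / 2) + c\<^sup>2 * sqrt (p * q))\<^sup>2 \<le>
      ((1 - c) / 2 * q + (1 + c) / 2 * p) * ((1 + c) / 2 * q + (1 - c) / 2 * p)"
    unfolding A_def G_def .
qed

text \<open>The Weierstrass product inequality. Applied to the affinities of the subtrees it makes
  the squared Hellinger distance subadditive.\<close>

lemma one_minus_prod_le_sum:
  fixes b :: "'i \<Rightarrow> real"
  assumes "finite I" "\<And>i. i \<in> I \<Longrightarrow> 0 \<le> b i \<and> b i \<le> 1"
  shows "1 - (\<Prod>i\<in>I. b i) \<le> (\<Sum>i\<in>I. 1 - b i)"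
  using assms
proof (induction I rule: finite_induct)
  case (insert i I)
  let ?P = "\<Prod>i\<in>I. b i"
  have "0 \<le> ?P" "?P \<le> 1" using insert.prems by (auto intro: prod_nonneg prod_le_1)
  then have "(1 - b i) * ?P \<le> 1 - b i" using insert.prems[of i] by (simp add: mult_left_le)
  with insert show ?case by (simp add: algebra_simps)
qed simp

lemma sum_sqrt_mult_le_1:
  fixes p q :: "'a \<Rightarrow> real"
  assumes "\<And>x. 0 \<le> p x" "\<And>x. 0 \<le> q x" "sum p C = 1" "sum q C = 1"
  shows "(\<Sum>x\<in>C. sqrt (p x * q x)) \<le> 1"
proof -
  have "(\<Sum>x\<in>C. sqrt (p x * q x)) \<le> (\<Sum>x\<in>C. (p x + q x) / 2)"
    by (intro sum_mono arith_geo_mean_sqrt assms)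
  also have "\<dots> = 1" using assms by (simp add: sum.distrib flip: sum_divide_distrib)
  finally show ?thesis .
qed

lemma sqrt_prod: "sqrt (\<Prod>i\<in>I. f i) = (\<Prod>i\<in>I. sqrt (f i))"
  by (induction I rule: infinite_finite_induct) (simp_all add: real_sqrt_mult)

text \<open>The affinity is multiplicative over the child subtrees, which are independent given the
  root. By \<open>sqrt_channel_ge\<close> the defect of each factor is at most
  \<open>\<theta>\<^sup>2\<close> times the defect of its subtree, and the defects add up as in
  \<open>level_energy\<close>.\<close>

lemma affinity_ge: "1 - level_energy \<beta> h N J \<le> affinity \<beta> h N J"
proof (induction h arbitrary: N J)
  case 0
  show ?case by (auto simp: affinity_def intro!: sum_nonneg)
next
  case (Suc h)
  let ?C = "\<lambda>i. configs (level (below i N) h)"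
  let ?c = "\<lambda>i. (edge_corr \<beta> (J [i]))\<^sup>2"
  let ?E = "\<lambda>i. level_energy \<beta> h (below i N) (below i J)"
  define b where "b i = (\<Sum>y\<in>?C i. sqrt (child_prob \<beta> h N J 1 i y * child_prob \<beta> h N J (-1) i y))" for i
  have aff: "affinity \<beta> (Suc h) N J = (\<Prod>i<N []. b i)"
    unfolding affinity_def level_prob_Suc b_def prod.distrib[symmetric] sqrt_prod
  proof (rule sum_configs_level_Suc)
    fix i and y y' :: "nat list \<Rightarrow> int"
    assume "\<And>v. v \<in> level (below i N) h \<Longrightarrow> y v = y' v"
    then have *: "child_prob \<beta> h N J s i y = child_prob \<beta> h N J s i y'" for s
      by (rule child_prob_cong)
    show "sqrt (child_prob \<beta> h N J 1 i y * child_prob \<beta> h N J (-1) i y) =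
        sqrt (child_prob \<beta> h N J 1 i y' * child_prob \<beta> h N J (-1) i y')"
      by (simp only: *)
  qed
  have b_ge: "1 - b i \<le> ?c i * ?E i" for i
  proof -
    let ?p = "level_prob \<beta> h (below i N) (below i J) 1"
    let ?q = "level_prob \<beta> h (below i N) (below i J) (-1)"
    have "(1 - ?c i) + ?c i * affinity \<beta> h (below i N) (below i J) =
        (\<Sum>y\<in>?C i. (1 - ?c i) * ((?p y + ?q y) / 2) + ?c i * sqrt (?p y * ?q y))"
      by (simp add: affinity_def sum.distrib sum_level_prob flip: sum_distrib_left sum_divide_distrib)
    also have "\<dots> \<le> b i"
      unfolding b_def
    proof (rule sum_mono)
      fix y
      show "(1 - ?c i) * ((?p y + ?q y) / 2) + ?c i * sqrt (?p y * ?q y) \<le>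
          sqrt (child_prob \<beta> h N J 1 i y * child_prob \<beta> h N J (-1) i y)"
        using sqrt_channel_ge[of "?p y" "?q y" "edge_corr \<beta> (J [i])"]
        by (simp add: child_prob_def spin_kernel_eq level_prob_nonneg edge_corr_sq_le_1)
    qed
    finally have "1 - b i \<le> ?c i * (1 - affinity \<beta> h (below i N) (below i J))"
      by (simp add: algebra_simps)
    also have "\<dots> \<le> ?c i * ?E i" using Suc.IH[of "below i N" "below i J"] by (intro mult_left_mono) auto
    finally show ?thesis .
  qed
  have "0 \<le> b i \<and> b i \<le> 1" for i
    unfolding b_def
    by (auto intro!: sum_nonneg sum_sqrt_mult_le_1 simp: child_prob_nonneg sum_child_prob_1)
  then have "1 - (\<Prod>i<N []. b i) \<le> (\<Sum>i<N []. 1 - b i)"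
    by (intro one_minus_prod_le_sum) auto
  also have "\<dots> \<le> level_energy \<beta> (Suc h) N J"
    using b_ge by (auto intro: sum_mono)
  finally show ?case by (simp add: aff)
qed

text \<open>Factor \<open>\<bar>p - q\<bar>\<close> as the difference times the sum of the square
  roots and apply weighted AM-GM. The squares then sum to 2 minus and 2 plus twice the affinity. The
  weight \<open>l\<close> stays free so that it can be chosen after averaging.\<close>

lemma level_tv_le:
  assumes "l > 0"
  shows "level_tv \<beta> h N J \<le> level_energy \<beta> h N J / l + l"
proof -
  let ?C = "configs (level N h)"
  let ?p = "level_prob \<beta> h N J 1" and ?q = "level_prob \<beta> h N J (-1)"
  have pointwise: "\<bar>?p x - ?q x\<bar> \<le> (?p x + ?q x - 2 * sqrt (?p x * ?q x)) / l +
      l / 4 * (?p x + ?q x + 2 * sqrt (?p x * ?q x))" for x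
  proof -
    define a where "a = sqrt (?p x)"
    define b where "b = sqrt (?q x)"
    have ab: "0 \<le> a" "0 \<le> b" "?p x = a\<^sup>2" "?q x = b\<^sup>2" "sqrt (?p x * ?q x) = a * b"
      by (simp_all add: a_def b_def level_prob_nonneg real_sqrt_mult)
    have "\<bar>a\<^sup>2 - b\<^sup>2\<bar> = \<bar>a - b\<bar> * (a + b)"
      using ab(1,2) by (simp add: power2_eq_square square_diff_square_factored abs_mult)
    also have "\<dots> \<le> (a - b)\<^sup>2 / l + l / 4 * (a + b)\<^sup>2"
    proof -
      have "0 \<le> (\<bar>a - b\<bar> - l / 2 * (a + b))\<^sup>2 / l" using assms by simp
      also have "\<dots> = (a - b)\<^sup>2 / l + l / 4 * (a + b)\<^sup>2 - \<bar>a - b\<bar> * (a + b)"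
        using assms by (simp add: power2_diff field_simps power2_eq_square)
      finally show ?thesis by simp
    qed
    finally show ?thesis unfolding ab(5) unfolding ab(3,4) by (simp add: power2_eq_square algebra_simps)
  qed
  have "2 * level_tv \<beta> h N J \<le> (\<Sum>x\<in>?C. (?p x + ?q x - 2 * sqrt (?p x * ?q x)) / l +
      l / 4 * (?p x + ?q x + 2 * sqrt (?p x * ?q x)))"
    unfolding level_tv_eq using pointwise by (simp add: sum_mono)
  also have "\<dots> = (2 - 2 * affinity \<beta> h N J) / l + l / 4 * (2 + 2 * affinity \<beta> h N J)"
    by (simp add: sum.distrib sum_subtractf sum_level_prob affinity_def
        flip: sum_distrib_left sum_divide_distrib)
  also have "\<dots> \<le> (2 * level_energy \<beta> h N J) / l + l / 4 * 4"
  proof (intro add_mono divide_right_mono mult_left_mono)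
    have "affinity \<beta> h N J \<le> 1"
      unfolding affinity_def by (rule sum_sqrt_mult_le_1) (auto simp: level_prob_nonneg sum_level_prob)
    then show "2 + 2 * affinity \<beta> h N J \<le> 4" by simp
  qed (use assms affinity_ge[of \<beta> h N J] in auto)
  finally show ?thesis using assms by simp
qed

text \<open>
  The statistic \<open>S\<close> and its second moment, which is the same for both root spins; \<open>W\<^sub>h\<close> is
  \<open>level_energy\<close>.
\<close>

primrec signal :: "real \<Rightarrow> nat \<Rightarrow> (nat list \<Rightarrow> nat) \<Rightarrow> (nat list \<Rightarrow> real) \<Rightarrow> (nat list \<Rightarrow> int) \<Rightarrow> real" where
  "signal \<beta> 0 N J x = of_int (x [])"
| "signal \<beta> (Suc h) N J x =
     (\<Sum>i<N []. edge_corr \<beta> (J [i]) * signal \<beta> h (below i N) (below i J) (below i x))"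

primrec signal_square :: "real \<Rightarrow> nat \<Rightarrow> (nat list \<Rightarrow> nat) \<Rightarrow> (nat list \<Rightarrow> real) \<Rightarrow> real" where
  "signal_square \<beta> 0 N J = 1"
| "signal_square \<beta> (Suc h) N J =
     (\<Sum>i<N []. (edge_corr \<beta> (J [i]))\<^sup>2 * signal_square \<beta> h (below i N) (below i J)) +
     (\<Sum>i<N []. \<Sum>j<N []. of_bool (i \<noteq> j) *
        ((edge_corr \<beta> (J [i]))\<^sup>2 * level_energy \<beta> h (below i N) (below i J)) *
        ((edge_corr \<beta> (J [j]))\<^sup>2 * level_energy \<beta> h (below j N) (below j J)))"

lemma signal_cong:
  "(\<And>v. v \<in> level N h \<Longrightarrow> x v = y v) \<Longrightarrow> signal \<beta> h N J x = signal \<beta> h N J y"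
proof (induction h arbitrary: N J x y)
  case 0
  then show ?case by (simp add: level_0)
next
  case (Suc h)
  have "signal \<beta> h (below i N) (below i J) (below i x) =
        signal \<beta> h (below i N) (below i J) (below i y)" if "i < N []" for i
    using that by (intro Suc.IH Suc.prems) (auto simp: level_Suc_root)
  then show ?case by simp
qed

text \<open>Conditional independence of the subtrees given the root spin. A child outside
  \<open>D\<close> gets the factor 1 and contributes its total mass 1. The cases used are one child
  and two distinct children.\<close>

lemma sum_level_prob_Suc_prod:
  fixes f :: "nat \<Rightarrow> (nat list \<Rightarrow> int) \<Rightarrow> real"
  assumes s: "s \<in> {-1, 1}" and D: "D \<subseteq> {..<N []}"
    and cong: "\<And>i y y'. i \<in> D \<Longrightarrow> (\<And>v. v \<in> level (below i N) h \<Longrightarrow> y v = y' v) \<Longrightarrow> f i y = f i y'"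
  shows "(\<Sum>x\<in>configs (level N (Suc h)). level_prob \<beta> (Suc h) N J s x * (\<Prod>i\<in>D. f i (below i x))) =
         (\<Prod>i\<in>D. \<Sum>y\<in>configs (level (below i N) h). child_prob \<beta> h N J s i y * f i y)"
proof -
  let ?f = "\<lambda>i y. if i \<in> D then f i y else 1"
  have "(\<Prod>i\<in>D. f i (below i x)) = (\<Prod>i<N []. ?f i (below i x))" for x
    using D by (intro prod.mono_neutral_cong_left) auto
  then have "(\<Sum>x\<in>configs (level N (Suc h)). level_prob \<beta> (Suc h) N J s x * (\<Prod>i\<in>D. f i (below i x))) =
      (\<Sum>x\<in>configs (level N (Suc h)). \<Prod>i<N []. child_prob \<beta> h N J s i (below i x) * ?f i (below i x))"
    by (simp only: level_prob_Suc prod.distrib)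
  also have "\<dots> = (\<Prod>i<N []. \<Sum>y\<in>configs (level (below i N) h). child_prob \<beta> h N J s i y * ?f i y)"
  proof (rule sum_configs_level_Suc)
    fix i and y y' :: "nat list \<Rightarrow> int"
    assume *: "\<And>v. v \<in> level (below i N) h \<Longrightarrow> y v = y' v"
    show "child_prob \<beta> h N J s i y * ?f i y = child_prob \<beta> h N J s i y' * ?f i y'"
      using child_prob_cong[OF *] cong[OF _ *] by simp
  qed
  also have "\<dots> = (\<Prod>i\<in>D. \<Sum>y\<in>configs (level (below i N) h). child_prob \<beta> h N J s i y * f i y)"
    using D by (intro prod.mono_neutral_cong_right) (auto simp: sum_child_prob_1[OF s])
  finally show ?thesis .
qed

text \<open>The two claims are proved together because the cross terms of the second moment are
  products of conditional means. The channel turns the mean for child spin \<open>t\<close> into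
  \<theta> times that for \<open>s\<close>, and the weight in \<open>signal\<close> supplies the
  second factor \<theta>.\<close>

lemma signal_moments:
  "s \<in> {-1, 1} \<Longrightarrow>
   (\<Sum>x\<in>configs (level N h). level_prob \<beta> h N J s x * signal \<beta> h N J x) = of_int s * level_energy \<beta> h N J \<and>
   (\<Sum>x\<in>configs (level N h). level_prob \<beta> h N J s x * (signal \<beta> h N J x)\<^sup>2) = signal_square \<beta> h N J"
proof (induction h arbitrary: N J s)
  case 0
  then show ?case by (auto simp: level_0 sum_configs_root)
next
  case (Suc h)
  let ?C = "configs (level N (Suc h))"
  let ?P = "level_prob \<beta> (Suc h) N J s"
  define f where "f i y = edge_corr \<beta> (J [i]) * signal \<beta> h (below i N) (below i J) y" for i y
  have f_cong: "f i y = f i y'" if "\<And>v. v \<in> level (below i N) h \<Longrightarrow> y v = y' v" for i y y'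
    unfolding f_def using signal_cong[OF that] by simp
  have mean: "(\<Sum>y\<in>configs (level (below i N) h). child_prob \<beta> h N J s i y * f i y) =
      of_int s * ((edge_corr \<beta> (J [i]))\<^sup>2 * level_energy \<beta> h (below i N) (below i J))" for i
  proof -
    have "(\<Sum>y\<in>configs (level (below i N) h). child_prob \<beta> h N J s i y * f i y) =
       edge_corr \<beta> (J [i]) * (\<Sum>y\<in>configs (level (below i N) h). child_prob \<beta> h N J s i y *
          signal \<beta> h (below i N) (below i J) y)"
      unfolding sum_distrib_left f_def by (intro sum.cong) auto
    also have "\<dots> = edge_corr \<beta> (J [i]) * (\<Sum>t\<in>{-1, 1}. spin_kernel \<beta> (J [i]) s t *
        (of_int t * level_energy \<beta> h (below i N) (below i J)))"
      unfolding sum_child_prob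
      using Suc.IH[of "-1" "below i N" "below i J"] Suc.IH[of 1 "below i N" "below i J"] by simp
    also have "\<dots> = of_int s * ((edge_corr \<beta> (J [i]))\<^sup>2 * level_energy \<beta> h (below i N) (below i J))"
      using Suc.prems by (auto simp: spin_kernel_eq power2_eq_square field_simps)
    finally show ?thesis .
  qed
  have square: "(\<Sum>y\<in>configs (level (below i N) h). child_prob \<beta> h N J s i y * (f i y)\<^sup>2) =
      (edge_corr \<beta> (J [i]))\<^sup>2 * signal_square \<beta> h (below i N) (below i J)" for i
  proof -
    have "(\<Sum>y\<in>configs (level (below i N) h). child_prob \<beta> h N J s i y * (f i y)\<^sup>2) =
       (edge_corr \<beta> (J [i]))\<^sup>2 * (\<Sum>y\<in>configs (level (below i N) h). child_prob \<beta> h N J s i y *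
          (signal \<beta> h (below i N) (below i J) y)\<^sup>2)"
      unfolding sum_distrib_left f_def by (intro sum.cong) (auto simp: power_mult_distrib)
    also have "\<dots> = (edge_corr \<beta> (J [i]))\<^sup>2 * (\<Sum>t\<in>{-1, 1}. spin_kernel \<beta> (J [i]) s t *
        signal_square \<beta> h (below i N) (below i J))"
      unfolding sum_child_prob[of \<beta> h N J s i "\<lambda>y. (signal \<beta> h (below i N) (below i J) y)\<^sup>2"]
      using Suc.IH[of "-1" "below i N" "below i J"] Suc.IH[of 1 "below i N" "below i J"] by simp
    finally show ?thesis
      using sum_spin_kernel[OF Suc.prems, of \<beta> "J [i]"] by (simp flip: sum_distrib_right distrib_right)
  qed
  have signal_eq: "signal \<beta> (Suc h) N J x = (\<Sum>i<N []. f i (below i x))" for x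
    by (simp add: f_def)
  have one: "(\<Sum>x\<in>?C. ?P x * g (below i x)) =
      (\<Sum>y\<in>configs (level (below i N) h). child_prob \<beta> h N J s i y * g y)"
    if "i < N []" "\<And>y y'. (\<And>v. v \<in> level (below i N) h \<Longrightarrow> y v = y' v) \<Longrightarrow> g y = g y'" for i g
  proof -
    have "(\<Sum>x\<in>?C. ?P x * (\<Prod>k\<in>{i}. g (below k x))) =
        (\<Prod>k\<in>{i}. \<Sum>y\<in>configs (level (below k N) h). child_prob \<beta> h N J s k y * g y)"
    proof (rule sum_level_prob_Suc_prod[OF Suc.prems])
      fix k and y y' :: "nat list \<Rightarrow> int"
      assume "k \<in> {i}" "\<And>v. v \<in> level (below k N) h \<Longrightarrow> y v = y' v"
      then show "g y = g y'" by (intro that(2)) auto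
    qed (use that(1) in auto)
    then show ?thesis by simp
  qed
  have "(\<Sum>x\<in>?C. ?P x * signal \<beta> (Suc h) N J x) = (\<Sum>i<N []. \<Sum>x\<in>?C. ?P x * f i (below i x))"
    unfolding signal_eq sum_distrib_left by (rule sum.swap)
  also have "\<dots> = (\<Sum>i<N []. of_int s * ((edge_corr \<beta> (J [i]))\<^sup>2 * level_energy \<beta> h (below i N) (below i J)))"
  proof (intro sum.cong refl)
    fix i assume "i \<in> {..<N []}"
    then have "(\<Sum>x\<in>?C. ?P x * f i (below i x)) =
        (\<Sum>y\<in>configs (level (below i N) h). child_prob \<beta> h N J s i y * f i y)"
      by (intro one f_cong) auto
    then show "(\<Sum>x\<in>?C. ?P x * f i (below i x)) =
        of_int s * ((edge_corr \<beta> (J [i]))\<^sup>2 * level_energy \<beta> h (below i N) (below i J))"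
      by (simp only: mean)
  qed
  finally have first: "(\<Sum>x\<in>?C. ?P x * signal \<beta> (Suc h) N J x) = of_int s * level_energy \<beta> (Suc h) N J"
    by (simp add: sum_distrib_left)
  have cross: "(\<Sum>x\<in>?C. ?P x * (f i (below i x) * f j (below j x))) =
      of_bool (i = j) * ((edge_corr \<beta> (J [i]))\<^sup>2 * signal_square \<beta> h (below i N) (below i J)) +
      of_bool (i \<noteq> j) * ((edge_corr \<beta> (J [i]))\<^sup>2 * level_energy \<beta> h (below i N) (below i J)) *
        ((edge_corr \<beta> (J [j]))\<^sup>2 * level_energy \<beta> h (below j N) (below j J))"
    if "i < N []" "j < N []" for i j
  proof (cases "i = j")
    case True
    have "(\<Sum>x\<in>?C. ?P x * (f i (below i x))\<^sup>2) =
        (\<Sum>y\<in>configs (level (below i N) h). child_prob \<beta> h N J s i y * (f i y)\<^sup>2)"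
      by (rule one[OF that(1), of "\<lambda>y. (f i y)\<^sup>2"]) (rule arg_cong[OF f_cong])
    with True square show ?thesis by (simp add: power2_eq_square)
  next
    case False
    \<comment> \<open>The root spin enters each mean as a sign, so it cancels in a product of
      two.\<close>
    have "of_int s * of_int s = (1 :: real)" using Suc.prems by auto
    then have sq: "(of_int s * a) * (of_int s * b) = a * b" for a b :: real
      by (metis mult.assoc mult.commute mult.left_neutral)
    have "(\<Sum>x\<in>?C. ?P x * (\<Prod>k\<in>{i, j}. f k (below k x))) =
        (\<Prod>k\<in>{i, j}. \<Sum>y\<in>configs (level (below k N) h). child_prob \<beta> h N J s k y * f k y)"
    proof (rule sum_level_prob_Suc_prod[OF Suc.prems])
      show "{i, j} \<subseteq> {..<N []}" using that by auto
    qed (rule f_cong)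
    with False show ?thesis by (simp add: mean sq)
  qed
  have "(signal \<beta> (Suc h) N J x)\<^sup>2 = (\<Sum>i<N []. \<Sum>j<N []. f i (below i x) * f j (below j x))" for x
    unfolding signal_eq power2_eq_square by (rule sum_product)
  then have "(\<Sum>x\<in>?C. ?P x * (signal \<beta> (Suc h) N J x)\<^sup>2) =
      (\<Sum>x\<in>?C. \<Sum>i<N []. \<Sum>j<N []. ?P x * (f i (below i x) * f j (below j x)))"
    by (simp only: sum_distrib_left)
  also have "\<dots> = (\<Sum>i<N []. \<Sum>j<N []. \<Sum>x\<in>?C. ?P x * (f i (below i x) * f j (below j x)))"
    by (subst sum.swap) (intro sum.cong refl sum.swap)
  also have "\<dots> = signal_square \<beta> (Suc h) N J"
    by (simp add: cross sum.distrib of_bool_def if_distrib[where f = "\<lambda>a. a * _"] sum.delta cong: if_cong)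
  finally show ?case using first by simp
qed

text \<open>The means of the signal under the two laws differ by
  \<open>2 * level_energy \<beta> h N J\<close>. Weighted AM-GM bounds the signal by its square plus
  a constant; \<open>\<bar>p - q\<bar> \<le> p + q\<close> is applied to the quadratic term only, so
  that the constant term keeps the total variation distance.\<close>

lemma level_energy_le:
  assumes "l > 0"
  shows "2 * level_energy \<beta> h N J \<le> l * signal_square \<beta> h N J + level_tv \<beta> h N J / l"
proof -
  let ?C = "configs (level N h)"
  let ?p = "level_prob \<beta> h N J 1" and ?q = "level_prob \<beta> h N J (-1)" and ?S = "signal \<beta> h N J"
  have "2 * level_energy \<beta> h N J = (\<Sum>x\<in>?C. ?p x * ?S x) - (\<Sum>x\<in>?C. ?q x * ?S x)"
    using signal_moments[of 1 \<beta> h N J] signal_moments[of "-1" \<beta> h N J] by simp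
  also have "\<dots> = (\<Sum>x\<in>?C. (?p x - ?q x) * ?S x)"
    by (simp add: sum_subtractf left_diff_distrib)
  also have "\<dots> \<le> (\<Sum>x\<in>?C. l / 2 * ((?p x + ?q x) * (?S x)\<^sup>2) + \<bar>?p x - ?q x\<bar> / (2 * l))"
  proof (rule sum_mono)
    fix x
    have "\<bar>?S x\<bar> \<le> l / 2 * (?S x)\<^sup>2 + 1 / (2 * l)"
    proof -
      have "0 \<le> (l * \<bar>?S x\<bar> - 1)\<^sup>2 / (2 * l)" using assms by simp
      also have "\<dots> = l / 2 * (?S x)\<^sup>2 + 1 / (2 * l) - \<bar>?S x\<bar>"
        using assms by (simp add: power2_diff power_mult_distrib field_simps) (simp add: power2_eq_square)
      finally show ?thesis by simp
    qed
    then have "\<bar>?p x - ?q x\<bar> * \<bar>?S x\<bar> \<le> \<bar>?p x - ?q x\<bar> * (l / 2 * (?S x)\<^sup>2 + 1 / (2 * l))"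
      by (intro mult_left_mono) auto
    also have "\<dots> = l / 2 * (\<bar>?p x - ?q x\<bar> * (?S x)\<^sup>2) + \<bar>?p x - ?q x\<bar> / (2 * l)"
      by (simp add: algebra_simps)
    also have "\<dots> \<le> l / 2 * ((?p x + ?q x) * (?S x)\<^sup>2) + \<bar>?p x - ?q x\<bar> / (2 * l)"
      using assms level_prob_nonneg[of \<beta> h N J 1 x] level_prob_nonneg[of \<beta> h N J "-1" x]
      by (intro add_mono mult_left_mono mult_right_mono) auto
    finally show "(?p x - ?q x) * ?S x \<le> l / 2 * ((?p x + ?q x) * (?S x)\<^sup>2) + \<bar>?p x - ?q x\<bar> / (2 * l)"
      using abs_ge_self[of "(?p x - ?q x) * ?S x"] by (simp add: abs_mult)
  qed
  also have "\<dots> = l / 2 * (\<Sum>x\<in>?C. (?p x + ?q x) * (?S x)\<^sup>2) + (\<Sum>x\<in>?C. \<bar>?p x - ?q x\<bar>) / (2 * l)"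
    by (simp add: sum.distrib sum_distrib_left sum_divide_distrib)
  also have "\<dots> = l * signal_square \<beta> h N J + level_tv \<beta> h N J / l"
    using signal_moments[of 1 \<beta> h N J] signal_moments[of "-1" \<beta> h N J] assms
    by (simp add: distrib_right sum.distrib level_tv_eq)
  finally show ?thesis .
qed

section \<open>Averaging over the Galton--Watson tree\<close>

text \<open>Labels are attached to all words, not only to vertices of the tree, so that passing to a
  subtree preserves the law.\<close>

abbreviation (input) iid :: "'a measure \<Rightarrow> (nat list \<Rightarrow> 'a) measure" where
  "iid M \<equiv> Pi\<^sub>M UNIV (\<lambda>_. M)"

lemma measurable_below:
  assumes "range ((#) i) \<subseteq> K"
  shows "(\<lambda>\<omega>. below i \<omega>) \<in> Pi\<^sub>M K (\<lambda>_. M) \<rightarrow>\<^sub>M iid M"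
proof (rule measurable_PiM_single')
  show "(\<lambda>\<omega>. \<omega> (i # v)) \<in> Pi\<^sub>M K (\<lambda>_. M) \<rightarrow>\<^sub>M M" for v
    using assms by (intro measurable_component_singleton) auto
qed (use assms in \<open>auto simp: space_PiM PiE_iff\<close>)

lemma nn_integral_iid_below:
  assumes M: "prob_space M" and g: "g \<in> borel_measurable (iid M)"
  shows "(\<integral>\<^sup>+\<omega>. g (below i \<omega>) \<partial>iid M) = (\<integral>\<^sup>+\<omega>. g \<omega> \<partial>iid M)"
proof -
  have "distr (iid M) (iid M) (\<lambda>\<omega>. below i \<omega>) = iid M"
    using distr_PiM_reindex[of UNIV "\<lambda>_. M" "(#) i" UNIV] M by (simp add: restrict_def)
  then have "(\<integral>\<^sup>+\<omega>. g \<omega> \<partial>iid M) = (\<integral>\<^sup>+\<omega>. g \<omega> \<partial>distr (iid M) (iid M) (\<lambda>\<omega>. below i \<omega>))"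
    by simp
  also have "\<dots> = (\<integral>\<^sup>+\<omega>. g (below i \<omega>) \<partial>iid M)"
    by (subst nn_integral_distr[OF measurable_below]) (use g in simp_all)
  finally show ?thesis ..
qed

lemma nn_integral_iid_component:
  assumes M: "prob_space M" and f: "f \<in> borel_measurable M"
  shows "(\<integral>\<^sup>+\<omega>. f (\<omega> v) \<partial>iid M) = (\<integral>\<^sup>+x. f x \<partial>M)"
proof -
  have "(\<integral>\<^sup>+x. f x \<partial>M) = (\<integral>\<^sup>+x. f x \<partial>distr (iid M) M (\<lambda>\<omega>. \<omega> v))"
    using distr_PiM_component[of UNIV "\<lambda>_. M" v] M by simp
  also have "\<dots> = (\<integral>\<^sup>+\<omega>. f (\<omega> v) \<partial>iid M)"
    by (subst nn_integral_distr) (use f in simp_all)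
  finally show ?thesis ..
qed

lemma indep_vars_iid_components:
  assumes M: "prob_space M"
  shows "prob_space.indep_vars (iid M) (\<lambda>_. M) (\<lambda>v \<omega>. \<omega> v) UNIV"
proof -
  interpret P: prob_space "iid M" by (intro prob_space_PiM M)
  have "distr (iid M) (iid M) (\<lambda>\<omega>. \<lambda>v\<in>UNIV. \<omega> v) = iid M"
    by (simp add: restrict_def)
  also have "\<dots> = Pi\<^sub>M UNIV (\<lambda>v. distr (iid M) M (\<lambda>\<omega>. \<omega> v))"
    by (subst distr_PiM_component[of UNIV "\<lambda>_. M"]) (auto intro: M)
  finally show ?thesis
    by (subst P.indep_vars_iff_distr_eq_PiM) auto
qed

text \<open>The root label and the families of labels below distinct children involve disjoint sets
  of coordinates, so functions of them are independent; each shifted family again has the law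
  \<open>iid M\<close>.\<close>

lemma nn_integral_iid_root_blocks:
  fixes f :: "'a \<Rightarrow> ennreal" and g :: "nat \<Rightarrow> (nat list \<Rightarrow> 'a) \<Rightarrow> ennreal"
  assumes M: "prob_space M" and fin: "finite I"
    and f: "f \<in> borel_measurable M" and g: "\<And>i. i \<in> I \<Longrightarrow> g i \<in> borel_measurable (iid M)"
  shows "(\<integral>\<^sup>+\<omega>. f (\<omega> []) * (\<Prod>i\<in>I. g i (below i \<omega>)) \<partial>iid M) =
         (\<integral>\<^sup>+x. f x \<partial>M) * (\<Prod>i\<in>I. \<integral>\<^sup>+\<omega>. g i \<omega> \<partial>iid M)"
proof -
  interpret P: prob_space "iid M" by (intro prob_space_PiM M)
  \<comment> \<open>\<open>None\<close> indexes the block of the root and \<open>Some i\<close> the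
    block of words beginning with \<open>i\<close>.\<close>
  define K where "K = case_option {[]} (\<lambda>i::nat. range ((#) i))"
  define Y where "Y k = case_option (\<lambda>x. f (x [])) (\<lambda>i x. g i (below i x)) k" for k
  let ?L = "insert None (Some ` I)"
  have "P.indep_vars (\<lambda>k. Pi\<^sub>M (K k) (\<lambda>_. M)) (\<lambda>k \<omega>. restrict (\<lambda>v. \<omega> v) (K k)) ?L"
    using indep_vars_iid_components[OF M]
    by (rule P.indep_vars_restrict) (auto simp: disjoint_family_on_def K_def split: option.splits)
  then have "P.indep_vars (\<lambda>_. borel) (\<lambda>k \<omega>. Y k (restrict \<omega> (K k))) ?L"
  proof (rule P.indep_vars_compose2)
    fix k assume "k \<in> ?L"
    then show "Y k \<in> Pi\<^sub>M (K k) (\<lambda>_. M) \<rightarrow>\<^sub>M borel"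
    proof
      assume "k = None"
      moreover have "(\<lambda>x. f (x [])) \<in> Pi\<^sub>M {[]} (\<lambda>_. M) \<rightarrow>\<^sub>M borel"
        by (rule measurable_compose[OF _ f]) (rule measurable_component_singleton, simp)
      ultimately show ?thesis by (simp add: Y_def K_def)
    next
      assume "k \<in> Some ` I"
      then obtain i where i: "k = Some i" "i \<in> I" by auto
      have "(\<lambda>x. g i (below i x)) \<in> Pi\<^sub>M (range ((#) i)) (\<lambda>_. M) \<rightarrow>\<^sub>M borel"
        by (rule measurable_compose[OF measurable_below g[OF i(2)]]) simp
      then show ?thesis by (simp add: Y_def K_def i)
    qed
  qed
  then have "(\<integral>\<^sup>+\<omega>. (\<Prod>k\<in>?L. Y k (restrict \<omega> (K k))) \<partial>iid M) =
      (\<Prod>k\<in>?L. \<integral>\<^sup>+\<omega>. Y k (restrict \<omega> (K k)) \<partial>iid M)"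
    using fin by (intro P.indep_vars_nn_integral) auto
  then have "(\<integral>\<^sup>+\<omega>. f (\<omega> []) * (\<Prod>i\<in>I. g i (below i \<omega>)) \<partial>iid M) =
      (\<integral>\<^sup>+\<omega>. f (\<omega> []) \<partial>iid M) * (\<Prod>i\<in>I. \<integral>\<^sup>+\<omega>. g i (below i \<omega>) \<partial>iid M)"
    using fin by (simp add: prod.reindex Y_def K_def)
  also have "\<dots> = (\<integral>\<^sup>+x. f x \<partial>M) * (\<Prod>i\<in>I. \<integral>\<^sup>+\<omega>. g i \<omega> \<partial>iid M)"
    by (simp add: nn_integral_iid_component[OF M f] nn_integral_iid_below[OF M g] cong: prod.cong)
  finally show ?thesis .
qed

lemma nn_integral_iid_root_block:
  fixes f :: "'a \<Rightarrow> ennreal"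
  assumes "prob_space M" "f \<in> borel_measurable M" "g \<in> borel_measurable (iid M)"
  shows "(\<integral>\<^sup>+\<omega>. f (\<omega> []) * g (below i \<omega>) \<partial>iid M) = (\<integral>\<^sup>+x. f x \<partial>M) * (\<integral>\<^sup>+\<omega>. g \<omega> \<partial>iid M)"
  using nn_integral_iid_root_blocks[of M "{i}" f "\<lambda>_. g"] assms by simp

lemma nn_integral_iid_root_two_blocks:
  fixes f :: "'a \<Rightarrow> ennreal"
  assumes "prob_space M" "i \<noteq> j" "f \<in> borel_measurable M"
    and "g \<in> borel_measurable (iid M)" "k \<in> borel_measurable (iid M)"
  shows "(\<integral>\<^sup>+\<omega>. f (\<omega> []) * (g (below i \<omega>) * k (below j \<omega>)) \<partial>iid M) =
         (\<integral>\<^sup>+x. f x \<partial>M) * ((\<integral>\<^sup>+\<omega>. g \<omega> \<partial>iid M) * (\<integral>\<^sup>+\<omega>. k \<omega> \<partial>iid M))"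
  using nn_integral_iid_root_blocks[of M "{i, j}" f "\<lambda>n. if n = i then g else k"] assms by simp

text \<open>With \<open>m\<close> the mean of \<open>\<theta>\<^sup>2\<close>, this and
  \<open>mean_square\<close> are the expectations of \<open>level_energy\<close> and
  \<open>signal_square\<close> over the couplings, the tree being fixed. This is shown in
  \<open>nn_integral_level_energy\<close> and \<open>nn_integral_signal_square\<close>.\<close>

primrec mean_energy :: "ennreal \<Rightarrow> nat \<Rightarrow> (nat list \<Rightarrow> nat) \<Rightarrow> ennreal" where
  "mean_energy m 0 N = 1"
| "mean_energy m (Suc h) N = (\<Sum>i<N []. m * mean_energy m h (below i N))"

primrec mean_square :: "ennreal \<Rightarrow> nat \<Rightarrow> (nat list \<Rightarrow> nat) \<Rightarrow> ennreal" where
  "mean_square m 0 N = 1"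
| "mean_square m (Suc h) N = (\<Sum>i<N []. m * mean_square m h (below i N)) +
     (\<Sum>i<N []. \<Sum>j<N []. of_bool (i \<noteq> j) *
        ((m * mean_energy m h (below i N)) * (m * mean_energy m h (below j N))))"

section \<open>Moments over the offspring numbers\<close>

abbreviation (input) gw :: "nat pmf \<Rightarrow> (nat list \<Rightarrow> nat) measure" where
  "gw \<zeta> \<equiv> Pi\<^sub>M UNIV (\<lambda>_. measure_pmf \<zeta>)"

lemma measurable_gw_children [measurable (raw)]: "(\<lambda>N. N v) \<in> gw \<zeta> \<rightarrow>\<^sub>M count_space UNIV"
proof -
  have "(\<lambda>N. N v) \<in> gw \<zeta> \<rightarrow>\<^sub>M measure_pmf \<zeta>" by (rule measurable_component_singleton) simp
  then show ?thesis by simp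
qed

lemma measurable_mean_energy: "mean_energy m h \<in> borel_measurable (gw \<zeta>)"
proof (induction h)
  case (Suc h)
  have [measurable]: "(\<lambda>N. mean_energy m h (below i N)) \<in> borel_measurable (gw \<zeta>)" for i
    by (rule measurable_compose[OF measurable_below Suc]) simp
  \<comment> \<open>The number of summands is random. Measurability is shown for each fixed number
    \<open>n\<close>, and \<open>n\<close> is then replaced by the countably valued
    \<open>N []\<close>.\<close>
  have "(\<lambda>N. \<Sum>i<n. m * mean_energy m h (below i N)) \<in> borel_measurable (gw \<zeta>)" for n :: nat
    by measurable
  from measurable_compose_countable[OF this measurable_gw_children] show ?case by simp
qed simp

lemma measurable_mean_square: "mean_square m h \<in> borel_measurable (gw \<zeta>)"
proof (induction h)
  case (Suc h)
  have [measurable]: "(\<lambda>N. mean_energy m h (below i N)) \<in> borel_measurable (gw \<zeta>)"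
    "(\<lambda>N. mean_square m h (below i N)) \<in> borel_measurable (gw \<zeta>)" for i
    by (rule measurable_compose[OF measurable_below], simp, fact measurable_mean_energy Suc)+
  have "(\<lambda>N. (\<Sum>i<n. m * mean_square m h (below i N)) +
     (\<Sum>i<n. \<Sum>j<n. of_bool (i \<noteq> j) *
        ((m * mean_energy m h (below i N)) * (m * mean_energy m h (below j N))))) \<in> borel_measurable (gw \<zeta>)"
    for n :: nat
    by measurable
  from measurable_compose_countable[OF this measurable_gw_children] show ?case by simp
qed simp

text \<open>Rewrites a sum of random length as a series whose terms are a function of
  \<open>N []\<close> times a function of the subtrees, the form to which independence
  applies.\<close>

lemma sum_lessThan_eq_suminf:
  "(\<Sum>i<n. a i) = (\<Sum>i. of_bool (i < n) * a i)" for a :: "nat \<Rightarrow> ennreal"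
proof -
  have "(\<Sum>i. of_bool (i < n) * a i) = (\<Sum>i<n. of_bool (i < n) * a i)"
    by (intro suminf_finite) auto
  then show ?thesis by simp
qed

text \<open>Wald's identity: the offspring number of the root is independent of the subtrees, and
  the indicators of \<open>i < n\<close> sum to \<open>n\<close>.\<close>

lemma nn_integral_gw_sum_children:
  assumes g: "g \<in> borel_measurable (gw \<zeta>)"
  shows "(\<integral>\<^sup>+N. (\<Sum>i<N []. g (below i N)) \<partial>gw \<zeta>) =
         (\<integral>\<^sup>+n. of_nat n \<partial>measure_pmf \<zeta>) * (\<integral>\<^sup>+N. g N \<partial>gw \<zeta>)"
proof -
  have [measurable]: "(\<lambda>N. g (below i N)) \<in> borel_measurable (gw \<zeta>)" for i
    by (rule measurable_compose[OF measurable_below g]) simp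
  have "(\<integral>\<^sup>+N. (\<Sum>i<N []. g (below i N)) \<partial>gw \<zeta>) =
      (\<Sum>i. \<integral>\<^sup>+N. of_bool (i < N []) * g (below i N) \<partial>gw \<zeta>)"
    unfolding sum_lessThan_eq_suminf by (intro nn_integral_suminf) measurable
  also have "\<dots> = (\<Sum>i. (\<integral>\<^sup>+n. of_bool (i < n) \<partial>measure_pmf \<zeta>) * (\<integral>\<^sup>+N. g N \<partial>gw \<zeta>))"
    by (intro suminf_cong nn_integral_iid_root_block[OF measure_pmf.prob_space_axioms _ g]) simp
  also have "\<dots> = (\<integral>\<^sup>+n. (\<Sum>i. of_bool (i < n)) \<partial>measure_pmf \<zeta>) * (\<integral>\<^sup>+N. g N \<partial>gw \<zeta>)"
    by (subst nn_integral_suminf) auto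
  also have "(\<lambda>n. (\<Sum>i. of_bool (i < n) :: ennreal)) = of_nat"
    using sum_lessThan_eq_suminf[of "\<lambda>_. 1"] by auto
  finally show ?thesis .
qed

text \<open>Two distinct subtrees are independent of each other and of the offspring number. The
  exact factor would be the mean of \<open>n * (n - 1)\<close>; bounding it by the second moment is
  enough.\<close>

lemma nn_integral_gw_sum_pairs_le:
  assumes g: "g \<in> borel_measurable (gw \<zeta>)"
  shows "(\<integral>\<^sup>+N. (\<Sum>i<N []. \<Sum>j<N []. of_bool (i \<noteq> j) * (g (below i N) * g (below j N))) \<partial>gw \<zeta>) \<le>
         (\<integral>\<^sup>+n. (of_nat n)\<^sup>2 \<partial>measure_pmf \<zeta>) * (\<integral>\<^sup>+N. g N \<partial>gw \<zeta>)\<^sup>2"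
proof -
  let ?G = "(\<integral>\<^sup>+N. g N \<partial>gw \<zeta>)\<^sup>2"
  let ?a = "\<lambda>i j n. of_bool (i < n) * (of_bool (j < n) * of_bool (i \<noteq> j)) :: ennreal"
  have [measurable]: "(\<lambda>N. g (below i N)) \<in> borel_measurable (gw \<zeta>)" for i
    by (rule measurable_compose[OF measurable_below g]) simp
  have "(\<integral>\<^sup>+N. (\<Sum>i<N []. \<Sum>j<N []. of_bool (i \<noteq> j) * (g (below i N) * g (below j N))) \<partial>gw \<zeta>) =
      (\<integral>\<^sup>+N. (\<Sum>i j. ?a i j (N []) * (g (below i N) * g (below j N))) \<partial>gw \<zeta>)"
    unfolding sum_lessThan_eq_suminf by (simp add: mult.assoc)
  also have "\<dots> = (\<Sum>i j. \<integral>\<^sup>+N. ?a i j (N []) * (g (below i N) * g (below j N)) \<partial>gw \<zeta>)"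
    by (subst nn_integral_suminf, measurable, intro suminf_cong nn_integral_suminf) measurable
  also have "\<dots> \<le> (\<Sum>i j. (\<integral>\<^sup>+n. of_bool (i < n) * of_bool (j < n) \<partial>measure_pmf \<zeta>) * ?G)"
  proof (intro suminf_le summableI)
    fix i j
    show "(\<integral>\<^sup>+N. ?a i j (N []) * (g (below i N) * g (below j N)) \<partial>gw \<zeta>) \<le>
        (\<integral>\<^sup>+n. of_bool (i < n) * of_bool (j < n) \<partial>measure_pmf \<zeta>) * ?G"
    proof (cases "i = j")
      case False
      have "(\<integral>\<^sup>+N. ?a i j (N []) * (g (below i N) * g (below j N)) \<partial>gw \<zeta>) =
          (\<integral>\<^sup>+n. ?a i j n \<partial>measure_pmf \<zeta>) * ?G"
        unfolding power2_eq_square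
        by (rule nn_integral_iid_root_two_blocks[OF measure_pmf.prob_space_axioms False _ g g]) simp
      with False show ?thesis by simp
    qed simp
  qed
  also have "\<dots> = (\<integral>\<^sup>+n. (\<Sum>i j. of_bool (i < n) * of_bool (j < n)) \<partial>measure_pmf \<zeta>) * ?G"
    by (subst nn_integral_suminf, simp, subst nn_integral_suminf) simp_all
  also have "(\<lambda>n. (\<Sum>i j. of_bool (i < n) * of_bool (j < n) :: ennreal)) = (\<lambda>n. (of_nat n)\<^sup>2)"
    using sum_lessThan_eq_suminf[of "\<lambda>_. 1"] by (auto simp: power2_eq_square)
  finally show ?thesis .
qed

lemma nn_integral_mean_energy:
  "(\<integral>\<^sup>+N. mean_energy m h N \<partial>gw \<zeta>) = ((\<integral>\<^sup>+n. of_nat n \<partial>measure_pmf \<zeta>) * m) ^ h"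
proof (induction h)
  case 0
  interpret P: prob_space "gw \<zeta>" by (intro prob_space_PiM measure_pmf.prob_space_axioms)
  show ?case by (simp add: P.emeasure_space_1)
next
  case (Suc h)
  have "(\<integral>\<^sup>+N. mean_energy m (Suc h) N \<partial>gw \<zeta>) =
      (\<integral>\<^sup>+n. of_nat n \<partial>measure_pmf \<zeta>) * (\<integral>\<^sup>+N. m * mean_energy m h N \<partial>gw \<zeta>)"
    unfolding mean_energy.simps
    by (rule nn_integral_gw_sum_children) (use measurable_mean_energy in measurable)
  also have "(\<integral>\<^sup>+N. m * mean_energy m h N \<partial>gw \<zeta>) = m * (\<integral>\<^sup>+N. mean_energy m h N \<partial>gw \<zeta>)"
    by (rule nn_integral_cmult[OF measurable_mean_energy])
  finally show ?case by (simp add: Suc mult.assoc)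
qed

text \<open>The diagonal terms give the linear part by Wald's identity; the cross terms involve only
  the mean energies, which are known powers of \<open>a\<close>.\<close>

lemma nn_integral_mean_square_Suc_le:
  fixes m :: ennreal and \<zeta> :: "nat pmf"
  defines "a \<equiv> (\<integral>\<^sup>+n. of_nat n \<partial>measure_pmf \<zeta>) * m"
  shows "(\<integral>\<^sup>+N. mean_square m (Suc h) N \<partial>gw \<zeta>) \<le> a * (\<integral>\<^sup>+N. mean_square m h N \<partial>gw \<zeta>) +
     (\<integral>\<^sup>+n. (of_nat n)\<^sup>2 \<partial>measure_pmf \<zeta>) * (m * a ^ h)\<^sup>2"
proof -
  note [measurable] = measurable_mean_energy measurable_mean_square
  have below [measurable]: "(\<lambda>N. mean_energy m h (below i N)) \<in> borel_measurable (gw \<zeta>)"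
    "(\<lambda>N. mean_square m h (below i N)) \<in> borel_measurable (gw \<zeta>)" for i
    by (rule measurable_compose[OF measurable_below], simp, fact measurable_mean_energy measurable_mean_square)+
  have "(\<lambda>N. \<Sum>i<n. m * mean_square m h (below i N)) \<in> borel_measurable (gw \<zeta>)"
    "(\<lambda>N. \<Sum>i<n. \<Sum>j<n. of_bool (i \<noteq> j) *
        ((m * mean_energy m h (below i N)) * (m * mean_energy m h (below j N)))) \<in> borel_measurable (gw \<zeta>)"
    for n :: nat by measurable
  note parts = this[THEN measurable_compose_countable[OF _ measurable_gw_children]]
  have "(\<integral>\<^sup>+N. mean_square m (Suc h) N \<partial>gw \<zeta>) =
      (\<integral>\<^sup>+N. (\<Sum>i<N []. m * mean_square m h (below i N)) \<partial>gw \<zeta>) +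
      (\<integral>\<^sup>+N. (\<Sum>i<N []. \<Sum>j<N []. of_bool (i \<noteq> j) *
        ((m * mean_energy m h (below i N)) * (m * mean_energy m h (below j N)))) \<partial>gw \<zeta>)"
    unfolding mean_square.simps by (rule nn_integral_add[OF parts])
  also have "\<dots> \<le> (\<integral>\<^sup>+n. of_nat n \<partial>measure_pmf \<zeta>) * (\<integral>\<^sup>+N. m * mean_square m h N \<partial>gw \<zeta>) +
      (\<integral>\<^sup>+n. (of_nat n)\<^sup>2 \<partial>measure_pmf \<zeta>) * (\<integral>\<^sup>+N. m * mean_energy m h N \<partial>gw \<zeta>)\<^sup>2"
    by (intro add_mono eq_refl[OF nn_integral_gw_sum_children] nn_integral_gw_sum_pairs_le) measurable
  also have "(\<integral>\<^sup>+N. m * mean_square m h N \<partial>gw \<zeta>) = m * (\<integral>\<^sup>+N. mean_square m h N \<partial>gw \<zeta>)"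
    by (rule nn_integral_cmult[OF measurable_mean_square])
  also have "(\<integral>\<^sup>+N. m * mean_energy m h N \<partial>gw \<zeta>) = m * a ^ h"
    by (simp add: nn_integral_cmult[OF measurable_mean_energy] nn_integral_mean_energy a_def)
  finally show ?thesis by (simp add: a_def mult.assoc)
qed

section \<open>Averaging over the couplings\<close>

lemma edge_corr_measurable [measurable]: "edge_corr \<beta> \<in> borel_measurable borel"
  unfolding edge_corr_def by measurable

lemma spin_kernel_measurable [measurable]: "(\<lambda>x. spin_kernel \<beta> x s t) \<in> borel_measurable borel"
  unfolding spin_kernel_def by measurable

text \<open>The couplings are an arbitrary measurable family \<open>g\<close>, so that the induction
  hypothesis covers the shifted ones. Only edges are constrained, since the couplings in
  \<open>expected_tv\<close> are indexed by the edges alone.\<close>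

lemma level_prob_measurable:
  "(\<And>v. v \<in> edges N h \<Longrightarrow> (\<lambda>\<omega>. g \<omega> v) \<in> borel_measurable M) \<Longrightarrow>
   (\<lambda>\<omega>. level_prob \<beta> h N (g \<omega>) s x) \<in> borel_measurable M"
proof (induction h arbitrary: N g s x)
  case (Suc h)
  have [measurable]: "(\<lambda>\<omega>. g \<omega> [i]) \<in> borel_measurable M"
    and [measurable]: "(\<lambda>\<omega>. level_prob \<beta> h (below i N) (below i (g \<omega>)) t (below i x)) \<in> borel_measurable M"
    if "i \<in> {..<N []}" for i t
  proof -
    show "(\<lambda>\<omega>. g \<omega> [i]) \<in> borel_measurable M"
      using that by (intro Suc.prems) (auto simp: edges_def Cons_in_vertices_Suc Nil_in_vertices)
    show "(\<lambda>\<omega>. level_prob \<beta> h (below i N) (below i (g \<omega>)) t (below i x)) \<in> borel_measurable M"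
      using that by (intro Suc.IH Suc.prems) (auto simp: edges_Suc vertices_eq_insert_edges)
  qed
  show ?case unfolding level_prob.simps by measurable
qed simp

lemma level_tv_measurable:
  "(\<And>v. v \<in> edges N h \<Longrightarrow> (\<lambda>\<omega>. g \<omega> v) \<in> borel_measurable M) \<Longrightarrow>
   (\<lambda>\<omega>. level_tv \<beta> h N (g \<omega>)) \<in> borel_measurable M"
  unfolding level_tv_eq
  by (intro borel_measurable_divide borel_measurable_sum borel_measurable_abs borel_measurable_diff
      level_prob_measurable borel_measurable_const)

lemma level_energy_measurable:
  "(\<And>v. (\<lambda>\<omega>. g \<omega> v) \<in> borel_measurable M) \<Longrightarrow>
   (\<lambda>\<omega>. level_energy \<beta> h N (g \<omega>)) \<in> borel_measurable M"
proof (induction h arbitrary: N g)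
  case (Suc h)
  note [measurable] = Suc.prems
  have [measurable]: "(\<lambda>\<omega>. level_energy \<beta> h (below i N) (below i (g \<omega>))) \<in> borel_measurable M" for i
    by (intro Suc.IH Suc.prems)
  show ?case unfolding level_energy.simps by measurable
qed simp

lemma signal_square_measurable:
  "(\<And>v. (\<lambda>\<omega>. g \<omega> v) \<in> borel_measurable M) \<Longrightarrow>
   (\<lambda>\<omega>. signal_square \<beta> h N (g \<omega>)) \<in> borel_measurable M"
proof (induction h arbitrary: N g)
  case (Suc h)
  note [measurable] = Suc.prems
  have [measurable]: "(\<lambda>\<omega>. signal_square \<beta> h (below i N) (below i (g \<omega>))) \<in> borel_measurable M"
    "(\<lambda>\<omega>. level_energy \<beta> h (below i N) (below i (g \<omega>))) \<in> borel_measurable M" for i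
    by (intro Suc.IH Suc.prems level_energy_measurable)+
  show ?case unfolding signal_square.simps by measurable
qed simp

lemma signal_square_nonneg: "0 \<le> signal_square \<beta> h N J"
  by (induction h arbitrary: N J) (auto intro!: sum_nonneg add_nonneg_nonneg simp: level_energy_nonneg)

lemma level_tv_bounds: "0 \<le> level_tv \<beta> h N J" "level_tv \<beta> h N J \<le> 1"
proof -
  let ?C = "configs (level N h)"
  show "0 \<le> level_tv \<beta> h N J" by (simp add: level_tv_eq sum_nonneg)
  have "(\<Sum>x\<in>?C. \<bar>level_prob \<beta> h N J 1 x - level_prob \<beta> h N J (-1) x\<bar>) \<le>
      (\<Sum>x\<in>?C. level_prob \<beta> h N J 1 x + level_prob \<beta> h N J (-1) x)"
  proof (rule sum_mono)
    fix x
    show "\<bar>level_prob \<beta> h N J 1 x - level_prob \<beta> h N J (-1) x\<bar> \<le>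
        level_prob \<beta> h N J 1 x + level_prob \<beta> h N J (-1) x"
      using level_prob_nonneg[of \<beta> h N J 1 x] level_prob_nonneg[of \<beta> h N J "-1" x] by linarith
  qed
  then show "level_tv \<beta> h N J \<le> 1" by (simp add: level_tv_eq sum.distrib sum_level_prob)
qed

section \<open>From the integrals in \<open>expected_tv\<close> to integrals over all words\<close>

lemma level_tv_restrict: "level_tv \<beta> h N (restrict J (edges N h)) = level_tv \<beta> h N J"
proof -
  have "gibbs_weight \<beta> N (restrict J (edges N h)) h = gibbs_weight \<beta> N J h"
    by (simp add: gibbs_weight_def fun_eq_iff)
  then show ?thesis by (simp only: level_law_def gibbs_def)
qed

lemma level_law_cong:
  assumes "vertices N h = vertices N' h"
  shows "level_law \<beta> N J h s = level_law \<beta> N' J h s"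
proof -
  have "level N h = {v \<in> vertices N h. length v = h}" for N
    by (auto simp: level_def vertices_def)
  then have "level N h = level N' h" using assms by simp
  moreover have "gibbs \<beta> N J h = gibbs \<beta> N' J h"
    unfolding gibbs_def gibbs_weight_def edges_def by (simp only: assms)
  ultimately show ?thesis by (simp add: level_law_def)
qed

text \<open>Such an \<open>F\<close> factors through the finite set \<open>vertices N h\<close>.
  There are countably many finite sets of words, so only the event that the truncated tree equals a
  given set has to be measurable.\<close>

lemma measurable_of_vertices:
  assumes "\<And>N N'. vertices N h = vertices N' h \<Longrightarrow> F N = F N'"
  shows "F \<in> gw \<zeta> \<rightarrow>\<^sub>M borel"
proof -
  define G where "G V = F (SOME N. vertices N h = V)" for V
  have F: "F = (\<lambda>N. G (vertices N h))"
  proof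
    fix N
    have "vertices (SOME N'. vertices N' h = vertices N h) h = vertices N h"
      by (rule someI[of "\<lambda>N'. vertices N' h = vertices N h" N]) (rule refl)
    then show "F N = G (vertices N h)" unfolding G_def by (intro assms) simp
  qed
  have tree: "Measurable.pred (gw \<zeta>) (\<lambda>N. v \<in> gw_tree N)" for v
  proof (induction v rule: rev_induct)
    case Nil
    show ?case by (simp add: gw_tree.root)
  next
    case (snoc j v)
    note [measurable] = this
    show ?case unfolding gw_tree_snoc by measurable
  qed
  have "(\<lambda>N. vertices N h) \<in> gw \<zeta> \<rightarrow>\<^sub>M count_space {V. finite V}"
  proof (subst measurable_count_space_eq_countable[OF countable_Collect_finite], intro conjI ballI)
    fix V :: "nat list set"
    note [measurable] = tree
    have "(\<lambda>N. vertices N h) -` {V} \<inter> space (gw \<zeta>) =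
        {N \<in> space (gw \<zeta>). \<forall>v. (v \<in> gw_tree N \<and> length v \<le> h) = (v \<in> V)}"
      by (auto simp: vertices_def)
    also have "\<dots> \<in> sets (gw \<zeta>)" by measurable
    finally show "(\<lambda>N. vertices N h) -` {V} \<inter> space (gw \<zeta>) \<in> sets (gw \<zeta>)" .
  qed (auto simp: finite_vertices)
  then show ?thesis unfolding F by (rule measurable_compose) simp
qed

text \<open>The definition integrates over couplings on the edges of the random tree, so the inner
  space varies with \<open>N\<close>. It is the image of the fixed space \<open>iid \<phi>\<close>
  under restriction, and the integrand, lying between 0 and 1, allows passage to nonnegative
  integrals.\<close>

lemma expected_tv_nn_integral:
  assumes "real_distribution \<phi>"
  shows "ennreal (expected_tv \<beta> \<phi> \<zeta> h) =
     (\<integral>\<^sup>+N. (\<integral>\<^sup>+J. ennreal (level_tv \<beta> h N J) \<partial>iid \<phi>) \<partial>gw \<zeta>)" (is ?eq)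
    and "(\<lambda>N. \<integral>\<^sup>+J. ennreal (level_tv \<beta> h N J) \<partial>iid \<phi>) \<in> borel_measurable (gw \<zeta>)" (is ?meas)
proof -
  interpret real_distribution \<phi> by fact
  interpret G: prob_space "gw \<zeta>" by (intro prob_space_PiM measure_pmf.prob_space_axioms)
  have sets: "sets \<phi> = sets borel" by simp
  define t where "t N = (\<integral>J. level_tv \<beta> h N J \<partial>(\<Pi>\<^sub>M v\<in>edges N h. \<phi>))" for N
  have meas_E: "(\<lambda>J. level_tv \<beta> h N J) \<in> borel_measurable (\<Pi>\<^sub>M v\<in>edges N h. \<phi>)" for N
  proof (rule level_tv_measurable)
    fix v assume "v \<in> edges N h"
    then have "(\<lambda>J. J v) \<in> (\<Pi>\<^sub>M v\<in>edges N h. \<phi>) \<rightarrow>\<^sub>M \<phi>" by (rule measurable_component_singleton)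
    then show "(\<lambda>J. J v) \<in> borel_measurable (\<Pi>\<^sub>M v\<in>edges N h. \<phi>)"
      by (simp cong: measurable_cong_sets add: sets)
  qed
  have t: "ennreal (t N) = (\<integral>\<^sup>+J. ennreal (level_tv \<beta> h N J) \<partial>iid \<phi>)" and t_bounds: "0 \<le> t N" "t N \<le> 1" for N
  proof -
    interpret E: prob_space "\<Pi>\<^sub>M v\<in>edges N h. \<phi>" by (intro prob_space_PiM prob_space_axioms)
    have int: "integrable (\<Pi>\<^sub>M v\<in>edges N h. \<phi>) (\<lambda>J. level_tv \<beta> h N J)"
      by (rule E.integrable_const_bound[where B = 1]) (use level_tv_bounds meas_E in auto)
    have "ennreal (t N) = (\<integral>\<^sup>+J. ennreal (level_tv \<beta> h N J) \<partial>(\<Pi>\<^sub>M v\<in>edges N h. \<phi>))"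
      unfolding t_def using int by (intro nn_integral_eq_integral[symmetric]) (auto simp: level_tv_bounds)
    also have "(\<Pi>\<^sub>M v\<in>edges N h. \<phi>) =
        distr (iid \<phi>) (\<Pi>\<^sub>M v\<in>edges N h. \<phi>) (\<lambda>J. restrict J (edges N h))"
      using distr_PiM_reindex[of UNIV "\<lambda>_. \<phi>" "\<lambda>v. v" "edges N h"] prob_space_axioms by simp
    also have "(\<integral>\<^sup>+J. ennreal (level_tv \<beta> h N J) \<partial>\<dots>) =
        (\<integral>\<^sup>+J. ennreal (level_tv \<beta> h N (restrict J (edges N h))) \<partial>iid \<phi>)"
      by (rule nn_integral_distr) (use meas_E[of N] in \<open>auto intro!: measurable_restrict\<close>)
    finally show "ennreal (t N) = (\<integral>\<^sup>+J. ennreal (level_tv \<beta> h N J) \<partial>iid \<phi>)"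
      by (simp add: level_tv_restrict)
    show "0 \<le> t N" unfolding t_def by (intro integral_nonneg_AE) (simp add: level_tv_bounds)
    have "t N \<le> (\<integral>J. 1 \<partial>(\<Pi>\<^sub>M v\<in>edges N h. \<phi>))"
      unfolding t_def by (intro integral_mono int) (auto simp: level_tv_bounds)
    then show "t N \<le> 1" by (simp add: E.prob_space)
  qed
  have t_meas: "t \<in> borel_measurable (gw \<zeta>)"
  proof (rule measurable_of_vertices)
    fix N N' assume "vertices N h = vertices N' h"
    then show "t N = t N'"
      unfolding t_def edges_def using level_law_cong[of N h N'] by simp
  qed
  then show ?meas by (simp flip: t)
  have "integrable (gw \<zeta>) t"
    by (rule G.integrable_const_bound[where B = 1]) (use t_bounds t_meas in auto)
  then have "ennreal (\<integral>N. t N \<partial>gw \<zeta>) = (\<integral>\<^sup>+N. ennreal (t N) \<partial>gw \<zeta>)"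
    by (intro nn_integral_eq_integral[symmetric]) (auto simp: t_bounds)
  then show ?eq by (simp only: expected_tv_def t_def[symmetric] t)
qed

lemma expected_tv_nonneg: "0 \<le> expected_tv \<beta> \<phi> \<zeta> h"
  unfolding expected_tv_def by (intro integral_nonneg_AE AE_I2) (simp add: level_tv_bounds)

context
  fixes \<beta> :: real and \<phi> :: "real measure" and m :: ennreal
  assumes \<phi>: "real_distribution \<phi>"
    and m: "m = (\<integral>\<^sup>+x. ennreal ((edge_corr \<beta> x)\<^sup>2) \<partial>\<phi>)"
begin

interpretation real_distribution \<phi> by (rule \<phi>)

lemma borel_measurable_coupling: "f \<in> borel_measurable borel \<Longrightarrow> f \<in> borel_measurable \<phi>"
  by simp

lemma component_measurable: "(\<lambda>J. J v) \<in> borel_measurable (iid \<phi>)"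
proof -
  have "(\<lambda>J. J v) \<in> iid \<phi> \<rightarrow>\<^sub>M \<phi>" by (rule measurable_component_singleton) simp
  then show ?thesis by (simp cong: measurable_cong_sets)
qed

lemma energy_measurable [measurable]: "level_energy \<beta> h N \<in> borel_measurable (iid \<phi>)"
  by (rule level_energy_measurable[of "\<lambda>J. J", OF component_measurable])

lemma square_measurable [measurable]: "signal_square \<beta> h N \<in> borel_measurable (iid \<phi>)"
  by (rule signal_square_measurable[of "\<lambda>J. J", OF component_measurable])

lemma corr_measurable [measurable]: "(\<lambda>J. edge_corr \<beta> (J v)) \<in> borel_measurable (iid \<phi>)"
  by (rule measurable_compose[OF component_measurable edge_corr_measurable])

lemma corr_sq_measurable: "(\<lambda>x. ennreal ((edge_corr \<beta> x)\<^sup>2)) \<in> borel_measurable \<phi>"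
  by (rule borel_measurable_coupling) measurable

text \<open>
  The coupling \<open>J []\<close> belongs to no edge of the tree. Seen from the parent it is the coupling of the
  edge above the root, and allowing a function of it as an extra factor lets the induction close.
\<close>

lemma nn_integral_level_energy:
  assumes "f \<in> borel_measurable \<phi>"
  shows "(\<integral>\<^sup>+J. f (J []) * ennreal (level_energy \<beta> h N J) \<partial>iid \<phi>) = (\<integral>\<^sup>+x. f x \<partial>\<phi>) * mean_energy m h N"
  using assms
proof (induction h arbitrary: N f)
  case 0
  then show ?case by (simp add: nn_integral_iid_component[OF prob_space_axioms])
next
  case (Suc h)
  define g where "g i J = ennreal ((edge_corr \<beta> (J []))\<^sup>2) * ennreal (level_energy \<beta> h (below i N) J)"
    for i :: nat and J :: "nat list \<Rightarrow> real"
  have [measurable]: "g i \<in> borel_measurable (iid \<phi>)" for i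
    unfolding g_def by measurable
  have [measurable]: "(\<lambda>J. g i (below i J)) \<in> borel_measurable (iid \<phi>)" for i
    by (rule measurable_compose[OF measurable_below]) (simp, measurable)
  have [measurable]: "(\<lambda>J. f (J [])) \<in> borel_measurable (iid \<phi>)"
    by (rule measurable_compose[OF _ Suc.prems]) (rule measurable_component_singleton, simp)
  have energy: "ennreal (level_energy \<beta> (Suc h) N J) = (\<Sum>i<N []. g i (below i J))" for J
    by (simp add: g_def level_energy_nonneg flip: sum_ennreal ennreal_mult)
  have "(\<integral>\<^sup>+J. f (J []) * ennreal (level_energy \<beta> (Suc h) N J) \<partial>iid \<phi>) =
      (\<Sum>i<N []. \<integral>\<^sup>+J. f (J []) * g i (below i J) \<partial>iid \<phi>)"
    unfolding energy sum_distrib_left by (rule nn_integral_sum) measurable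
  also have "\<dots> = (\<Sum>i<N []. (\<integral>\<^sup>+x. f x \<partial>\<phi>) * (m * mean_energy m h (below i N)))"
  proof (intro sum.cong refl)
    fix i
    have "(\<integral>\<^sup>+J. g i J \<partial>iid \<phi>) = m * mean_energy m h (below i N)"
      unfolding g_def m by (rule Suc.IH[OF corr_sq_measurable, unfolded m])
    then show "(\<integral>\<^sup>+J. f (J []) * g i (below i J) \<partial>iid \<phi>) =
        (\<integral>\<^sup>+x. f x \<partial>\<phi>) * (m * mean_energy m h (below i N))"
      using nn_integral_iid_root_block[OF prob_space_axioms Suc.prems, of "g i" i] by simp
  qed
  finally show ?case by (simp add: sum_distrib_left)
qed

text \<open>As for the energy; in a cross term the two children give two disjoint blocks of
  couplings, so the mean is the product of two mean energies.\<close>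

lemma nn_integral_signal_square:
  assumes "f \<in> borel_measurable \<phi>"
  shows "(\<integral>\<^sup>+J. f (J []) * ennreal (signal_square \<beta> h N J) \<partial>iid \<phi>) = (\<integral>\<^sup>+x. f x \<partial>\<phi>) * mean_square m h N"
  using assms
proof (induction h arbitrary: N f)
  case 0
  then show ?case by (simp add: nn_integral_iid_component[OF prob_space_axioms])
next
  case (Suc h)
  define g where "g i J = ennreal ((edge_corr \<beta> (J []))\<^sup>2) * ennreal (level_energy \<beta> h (below i N) J)"
    for i :: nat and J :: "nat list \<Rightarrow> real"
  define q where "q i J = ennreal ((edge_corr \<beta> (J []))\<^sup>2) * ennreal (signal_square \<beta> h (below i N) J)"
    for i :: nat and J :: "nat list \<Rightarrow> real"
  have [measurable]: "g i \<in> borel_measurable (iid \<phi>)" "q i \<in> borel_measurable (iid \<phi>)" for i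
    unfolding g_def q_def by measurable
  have [measurable]: "(\<lambda>J. g i (below i J)) \<in> borel_measurable (iid \<phi>)"
    "(\<lambda>J. q i (below i J)) \<in> borel_measurable (iid \<phi>)" for i
    by (rule measurable_compose[OF measurable_below]; simp; measurable)+
  have [measurable]: "(\<lambda>J. f (J [])) \<in> borel_measurable (iid \<phi>)"
    by (rule measurable_compose[OF _ Suc.prems]) (rule measurable_component_singleton, simp)
  have g_int: "(\<integral>\<^sup>+J. g i J \<partial>iid \<phi>) = m * mean_energy m h (below i N)" for i
    unfolding g_def using nn_integral_level_energy[OF corr_sq_measurable] by (simp add: m)
  have q_int: "(\<integral>\<^sup>+J. q i J \<partial>iid \<phi>) = m * mean_square m h (below i N)" for i
    unfolding q_def using Suc.IH[OF corr_sq_measurable] by (simp add: m)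
  have "ennreal (of_bool P * (a * b) * (c * d)) = of_bool P * (ennreal a * ennreal b * (ennreal c * ennreal d))"
    if "0 \<le> a" "0 \<le> b" "0 \<le> c" "0 \<le> d" for P and a b c d :: real
    using that by (cases P) (simp_all flip: ennreal_mult)
  then have "ennreal (\<Sum>i<N []. \<Sum>j<N []. of_bool (i \<noteq> j) *
        ((edge_corr \<beta> (J [i]))\<^sup>2 * level_energy \<beta> h (below i N) (below i J)) *
        ((edge_corr \<beta> (J [j]))\<^sup>2 * level_energy \<beta> h (below j N) (below j J))) =
     (\<Sum>i<N []. \<Sum>j<N []. of_bool (i \<noteq> j) * (g i (below i J) * g j (below j J)))" for J
    by (simp add: g_def level_energy_nonneg sum_nonneg flip: sum_ennreal)
  moreover have "ennreal (\<Sum>i<N []. (edge_corr \<beta> (J [i]))\<^sup>2 * signal_square \<beta> h (below i N) (below i J)) =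
      (\<Sum>i<N []. q i (below i J))" for J
    by (simp add: q_def signal_square_nonneg flip: sum_ennreal ennreal_mult)
  ultimately have square: "ennreal (signal_square \<beta> (Suc h) N J) = (\<Sum>i<N []. q i (below i J)) +
      (\<Sum>i<N []. \<Sum>j<N []. of_bool (i \<noteq> j) * (g i (below i J) * g j (below j J)))" for J
    by (simp add: ennreal_plus sum_nonneg level_energy_nonneg signal_square_nonneg)
  have comm: "y * (of_bool P * x) = of_bool P * (y * x)" for P and x y :: ennreal
    by (cases P) simp_all
  have "(\<integral>\<^sup>+J. f (J []) * ennreal (signal_square \<beta> (Suc h) N J) \<partial>iid \<phi>) =
      (\<integral>\<^sup>+J. (\<Sum>i<N []. f (J []) * q i (below i J)) +
        (\<Sum>i<N []. \<Sum>j<N []. of_bool (i \<noteq> j) * (f (J []) * (g i (below i J) * g j (below j J)))) \<partial>iid \<phi>)"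
    by (simp only: square comm distrib_left sum_distrib_left)
  also have "\<dots> = (\<Sum>i<N []. \<integral>\<^sup>+J. f (J []) * q i (below i J) \<partial>iid \<phi>) +
      (\<Sum>i<N []. \<Sum>j<N []. of_bool (i \<noteq> j) *
         (\<integral>\<^sup>+J. f (J []) * (g i (below i J) * g j (below j J)) \<partial>iid \<phi>))"
    by (simp add: nn_integral_add nn_integral_sum nn_integral_cmult del: sum_of_bool_mult_eq sum_mult_of_bool_eq)
  also have "\<dots> = (\<Sum>i<N []. (\<integral>\<^sup>+x. f x \<partial>\<phi>) * (m * mean_square m h (below i N))) +
      (\<Sum>i<N []. \<Sum>j<N []. of_bool (i \<noteq> j) * ((\<integral>\<^sup>+x. f x \<partial>\<phi>) *
        ((m * mean_energy m h (below i N)) * (m * mean_energy m h (below j N)))))"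
  proof (intro arg_cong2[where f = "(+)"] sum.cong refl)
    fix i
    show "(\<integral>\<^sup>+J. f (J []) * q i (below i J) \<partial>iid \<phi>) = (\<integral>\<^sup>+x. f x \<partial>\<phi>) * (m * mean_square m h (below i N))"
      using nn_integral_iid_root_block[OF prob_space_axioms Suc.prems, of "q i" i] by (simp add: q_int)
    fix j
    show "of_bool (i \<noteq> j) * (\<integral>\<^sup>+J. f (J []) * (g i (below i J) * g j (below j J)) \<partial>iid \<phi>) =
        of_bool (i \<noteq> j) * ((\<integral>\<^sup>+x. f x \<partial>\<phi>) *
        ((m * mean_energy m h (below i N)) * (m * mean_energy m h (below j N))))"
      using nn_integral_iid_root_two_blocks[OF prob_space_axioms _ Suc.prems, of i j "g i" "g j"]
      by (cases "i = j") (simp_all add: g_int)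
  qed
  finally show ?case by (simp only: mean_square.simps comm distrib_left sum_distrib_left)
qed

lemma iid_measure_1: "emeasure (iid \<phi>) (space (iid \<phi>)) = 1"
  by (intro prob_space.emeasure_space_1 prob_space_PiM prob_space_axioms)

lemma nn_integral_level_energy_1: "(\<integral>\<^sup>+J. ennreal (level_energy \<beta> h N J) \<partial>iid \<phi>) = mean_energy m h N"
  using nn_integral_level_energy[of "\<lambda>_. 1" h N] emeasure_space_1 by simp

lemma nn_integral_signal_square_1: "(\<integral>\<^sup>+J. ennreal (signal_square \<beta> h N J) \<partial>iid \<phi>) = mean_square m h N"
  using nn_integral_signal_square[of "\<lambda>_. 1" h N] emeasure_space_1 by simp

lemma expected_tv_le:
  assumes "l > 0"
  shows "ennreal (expected_tv \<beta> \<phi> \<zeta> h) \<le>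
     ennreal (1 / l) * (\<integral>\<^sup>+N. mean_energy m h N \<partial>gw \<zeta>) + ennreal l"
proof -
  interpret G: prob_space "gw \<zeta>" by (intro prob_space_PiM measure_pmf.prob_space_axioms)
  have "ennreal (expected_tv \<beta> \<phi> \<zeta> h) \<le>
      (\<integral>\<^sup>+N. (\<integral>\<^sup>+J. ennreal (1 / l) * ennreal (level_energy \<beta> h N J) + ennreal l \<partial>iid \<phi>) \<partial>gw \<zeta>)"
    unfolding expected_tv_nn_integral(1)[OF \<phi>]
  proof (intro nn_integral_mono)
    fix N J
    have "ennreal (level_tv \<beta> h N J) \<le> ennreal (1 / l * level_energy \<beta> h N J + l)"
      using level_tv_le[OF assms, of \<beta> N J h] by (intro ennreal_leI) simp
    also have "\<dots> = ennreal (1 / l) * ennreal (level_energy \<beta> h N J) + ennreal l"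
      using assms level_energy_nonneg[of \<beta> h N J] by (subst ennreal_plus) (simp_all flip: ennreal_mult)
    finally show "ennreal (level_tv \<beta> h N J) \<le> \<dots>" .
  qed
  also have "\<dots> = (\<integral>\<^sup>+N. ennreal (1 / l) * mean_energy m h N + ennreal l \<partial>gw \<zeta>)"
    by (simp add: nn_integral_add nn_integral_cmult nn_integral_level_energy_1 iid_measure_1)
  also have "\<dots> = ennreal (1 / l) * (\<integral>\<^sup>+N. mean_energy m h N \<partial>gw \<zeta>) + ennreal l"
    using measurable_mean_energy[where m = m and h = h and \<zeta> = \<zeta>]
    by (simp add: nn_integral_add nn_integral_cmult G.emeasure_space_1)
  finally show ?thesis .
qed

lemma expected_tv_ge:
  assumes "l > 0"
  shows "2 * (\<integral>\<^sup>+N. mean_energy m h N \<partial>gw \<zeta>) \<le>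
     ennreal l * (\<integral>\<^sup>+N. mean_square m h N \<partial>gw \<zeta>) + ennreal (1 / l) * ennreal (expected_tv \<beta> \<phi> \<zeta> h)"
proof -
  have tv_meas [measurable]: "(\<lambda>J. level_tv \<beta> h N J) \<in> borel_measurable (iid \<phi>)" for N
    by (rule level_tv_measurable[of _ _ "\<lambda>J. J", OF component_measurable])
  have "2 * (\<integral>\<^sup>+N. mean_energy m h N \<partial>gw \<zeta>) =
      (\<integral>\<^sup>+N. (\<integral>\<^sup>+J. 2 * ennreal (level_energy \<beta> h N J) \<partial>iid \<phi>) \<partial>gw \<zeta>)"
    using measurable_mean_energy[where m = m and h = h and \<zeta> = \<zeta>] by (simp add: nn_integral_cmult nn_integral_level_energy_1)
  also have "\<dots> \<le> (\<integral>\<^sup>+N. (\<integral>\<^sup>+J. ennreal l * ennreal (signal_square \<beta> h N J) +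
      ennreal (1 / l) * ennreal (level_tv \<beta> h N J) \<partial>iid \<phi>) \<partial>gw \<zeta>)"
  proof (intro nn_integral_mono)
    fix N J
    have "2 * ennreal (level_energy \<beta> h N J) = ennreal (2 * level_energy \<beta> h N J)"
      by (simp add: ennreal_mult level_energy_nonneg)
    also have "\<dots> \<le> ennreal (l * signal_square \<beta> h N J + 1 / l * level_tv \<beta> h N J)"
      using level_energy_le[OF assms, of \<beta> h N J] by (intro ennreal_leI) simp
    also have "\<dots> = ennreal l * ennreal (signal_square \<beta> h N J) + ennreal (1 / l) * ennreal (level_tv \<beta> h N J)"
      using assms signal_square_nonneg[of \<beta> h N J] level_tv_bounds(1)[of \<beta> N J h]
      by (subst ennreal_plus) (simp_all flip: ennreal_mult)
    finally show "2 * ennreal (level_energy \<beta> h N J) \<le> \<dots>" .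
  qed
  also have "\<dots> = (\<integral>\<^sup>+N. ennreal l * mean_square m h N +
      ennreal (1 / l) * (\<integral>\<^sup>+J. ennreal (level_tv \<beta> h N J) \<partial>iid \<phi>) \<partial>gw \<zeta>)"
    by (simp add: nn_integral_add nn_integral_cmult nn_integral_signal_square_1)
  also have "\<dots> = ennreal l * (\<integral>\<^sup>+N. mean_square m h N \<partial>gw \<zeta>) +
      ennreal (1 / l) * ennreal (expected_tv \<beta> \<phi> \<zeta> h)"
    using measurable_mean_square[where m = m and h = h and \<zeta> = \<zeta>] expected_tv_nn_integral(2)[OF \<phi>, where \<beta> = \<beta> and h = h and \<zeta> = \<zeta>]
    by (simp add: nn_integral_add nn_integral_cmult expected_tv_nn_integral(1)[OF \<phi>])
  finally show ?thesis .
qed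

end

section \<open>The two sides of the threshold\<close>

theorem theorem2p4:
  fixes d \<beta> :: real and \<phi> :: "real measure" and \<zeta> :: "nat pmf"
  assumes "d > 0" and "\<beta> > 0"
    and "real_distribution \<phi>"
    and "measure_pmf.expectation \<zeta> real = d"
    and "integrable (measure_pmf \<zeta>) (\<lambda>n. (real n)\<^sup>2)"
  shows "(ereal d > KS_threshold \<beta> \<phi> \<longrightarrow> reconstruction \<beta> \<phi> \<zeta>) \<and>
         (ereal d < KS_threshold \<beta> \<phi> \<longrightarrow> non_reconstruction \<beta> \<phi> \<zeta>)"
proof -
  interpret real_distribution \<phi> by fact
  let ?T = "expected_tv \<beta> \<phi> \<zeta>"
  define \<kappa> where "\<kappa> = (\<integral>x. (edge_corr \<beta> x)\<^sup>2 \<partial>\<phi>)"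
  define a where "a = d * \<kappa>"
  define D where "D = measure_pmf.expectation \<zeta> (\<lambda>n. (real n)\<^sup>2)"
  have "((1 - exp (\<beta> * x)) / (1 + exp (\<beta> * x)))\<^sup>2 = (edge_corr \<beta> x)\<^sup>2" for x
    unfolding edge_corr_def by (simp add: power_divide power2_commute add.commute)
  then have KS: "KS_threshold \<beta> \<phi> = inverse (ereal \<kappa>)"
    by (simp only: KS_threshold_def \<kappa>_def)
  have int_corr: "integrable \<phi> (\<lambda>x. (edge_corr \<beta> x)\<^sup>2)"
    by (rule integrable_const_bound[where B = 1]) (auto simp: edge_corr_sq_le_1)
  then have \<kappa>: "ennreal \<kappa> = (\<integral>\<^sup>+x. ennreal ((edge_corr \<beta> x)\<^sup>2) \<partial>\<phi>)"
    unfolding \<kappa>_def by (intro nn_integral_eq_integral[symmetric]) auto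
  have \<kappa>0: "0 \<le> \<kappa>" unfolding \<kappa>_def by (intro integral_nonneg_AE) simp
  have a0: "0 \<le> a" using \<kappa>0 \<open>d > 0\<close> by (simp add: a_def)
  have D0: "0 \<le> D" unfolding D_def by (intro integral_nonneg_AE) simp
  have D: "(\<integral>\<^sup>+n. (of_nat n)\<^sup>2 \<partial>measure_pmf \<zeta>) = ennreal D"
    unfolding D_def using nn_integral_eq_integral[OF assms(5)]
    by (simp add: ennreal_of_nat_eq_real_of_nat ennreal_power)
  \<comment> \<open>The Bochner integral of a non-integrable function is 0, while this one equals
    \<open>d > 0\<close>.\<close>
  have "integrable (measure_pmf \<zeta>) real"
    using assms(1,4) not_integrable_integral_eq by fastforce
  then have d: "(\<integral>\<^sup>+n. of_nat n \<partial>measure_pmf \<zeta>) = ennreal d"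
    using nn_integral_eq_integral[of "measure_pmf \<zeta>" real] assms(4)
    by (simp add: ennreal_of_nat_eq_real_of_nat)
  have energy: "(\<integral>\<^sup>+N. mean_energy (ennreal \<kappa>) h N \<partial>gw \<zeta>) = ennreal (a ^ h)" for h
    using \<kappa>0 \<open>d > 0\<close> by (simp add: nn_integral_mean_energy d a_def ennreal_power flip: ennreal_mult)
  have "reconstruction \<beta> \<phi> \<zeta>" if "ereal d > KS_threshold \<beta> \<phi>"
  proof -
    \<comment> \<open>For \<open>\<kappa> = 0\<close> the threshold is \<infinity>, which no real
      \<open>d\<close> exceeds.\<close>
    have "\<kappa> \<noteq> 0" using that by (auto simp: KS)
    then have "\<kappa> > 0" using \<kappa>0 by simp
    then have a1: "a > 1" using that by (simp add: KS a_def field_simps)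
    \<comment> \<open>The second entry makes
      \<open>C * a + D * \<kappa>\<^sup>2 \<le> C * a\<^sup>2\<close>, which closes the induction
      for \<open>square\<close>; the entry 1 serves its base case.\<close>
    define C where "C = max 1 (D * \<kappa>\<^sup>2 / (a * (a - 1)))"
    have C: "C \<ge> 1" "C * (a * (a - 1)) \<ge> D * \<kappa>\<^sup>2"
    proof -
      show "C \<ge> 1" by (simp add: C_def)
      have "D * \<kappa>\<^sup>2 / (a * (a - 1)) \<le> C" by (simp add: C_def)
      then show "C * (a * (a - 1)) \<ge> D * \<kappa>\<^sup>2" using a1 by (subst (asm) pos_divide_le_eq) auto
    qed
    have square: "(\<integral>\<^sup>+N. mean_square (ennreal \<kappa>) h N \<partial>gw \<zeta>) \<le> ennreal (C * (a ^ h)\<^sup>2)" for h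
    proof (induction h)
      case 0
      interpret G: prob_space "gw \<zeta>" by (intro prob_space_PiM measure_pmf.prob_space_axioms)
      show ?case using C(1) by (simp add: G.emeasure_space_1)
    next
      case (Suc h)
      have "(\<integral>\<^sup>+N. mean_square (ennreal \<kappa>) (Suc h) N \<partial>gw \<zeta>) \<le>
          ennreal a * (\<integral>\<^sup>+N. mean_square (ennreal \<kappa>) h N \<partial>gw \<zeta>) + ennreal (D * (\<kappa> * a ^ h)\<^sup>2)"
        using nn_integral_mean_square_Suc_le[of \<zeta> "ennreal \<kappa>" h] \<kappa>0 \<open>d > 0\<close> a0 D0
        by (simp add: d D a_def ennreal_power flip: ennreal_mult)
      also have "\<dots> \<le> ennreal a * ennreal (C * (a ^ h)\<^sup>2) + ennreal (D * (\<kappa> * a ^ h)\<^sup>2)"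
        by (intro add_mono mult_left_mono Suc) auto
      also have "\<dots> = ennreal ((C * a + D * \<kappa>\<^sup>2) * (a ^ h)\<^sup>2)"
        using a0 C(1) D0
        by (simp add: algebra_simps power_mult_distrib flip: ennreal_mult ennreal_plus)
      also have "\<dots> \<le> ennreal ((C * a\<^sup>2) * (a ^ h)\<^sup>2)"
        using C(2) by (intro ennreal_leI mult_right_mono) (auto simp: algebra_simps power2_eq_square)
      finally show ?case by (simp add: power_mult_distrib mult_ac)
    qed
    have "1 / C \<le> ?T h" for h
    proof -
      have ah: "a ^ h > 0" using a1 by simp
      \<comment> \<open>With this weight the second moment term is at most \<open>a ^ h\<close>,
        half of the left side, and the total variation term has to supply the other half.\<close>
      define l where "l = 1 / (C * a ^ h)"
      have l: "l > 0" using C(1) ah by (simp add: l_def)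
      have "ennreal (2 * a ^ h) = 2 * (\<integral>\<^sup>+N. mean_energy (ennreal \<kappa>) h N \<partial>gw \<zeta>)"
        unfolding energy using ah by (simp add: ennreal_mult)
      also have "\<dots> \<le> ennreal l * (\<integral>\<^sup>+N. mean_square (ennreal \<kappa>) h N \<partial>gw \<zeta>) + ennreal (1 / l) * ennreal (?T h)"
        by (rule expected_tv_ge[OF assms(3) \<kappa> l])
      also have "\<dots> \<le> ennreal l * ennreal (C * (a ^ h)\<^sup>2) + ennreal (1 / l) * ennreal (?T h)"
        by (intro add_mono mult_left_mono square) auto
      also have "\<dots> = ennreal (l * (C * (a ^ h)\<^sup>2) + 1 / l * ?T h)"
        using l C(1) expected_tv_nonneg[of \<beta> \<phi> \<zeta> h] by (simp flip: ennreal_mult ennreal_plus)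
      also have "l * (C * (a ^ h)\<^sup>2) = a ^ h"
        using C(1) ah by (simp add: l_def power2_eq_square)
      finally have "2 * a ^ h \<le> a ^ h + C * a ^ h * ?T h"
        using ah C(1) expected_tv_nonneg[of \<beta> \<phi> \<zeta> h] by (subst (asm) ennreal_le_iff) (auto simp: l_def)
      then have "a ^ h * 1 \<le> a ^ h * (C * ?T h)" by (simp add: mult_ac)
      then have "1 \<le> C * ?T h" using ah by (subst (asm) mult_le_cancel_left_pos)
      then show ?thesis using C(1) by (simp add: field_simps)
    qed
    then have "ereal (1 / C) \<le> limsup (\<lambda>h. ereal (?T h))"
      by (intro le_Limsup) auto
    moreover have "0 < ereal (1 / C)" using C(1) by simp
    ultimately show ?thesis unfolding reconstruction_def by (rule less_le_trans[rotated])
  qed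
  moreover have "non_reconstruction \<beta> \<phi> \<zeta>" if "ereal d < KS_threshold \<beta> \<phi>"
  proof -
    have a1: "a < 1"
    proof (cases "\<kappa> = 0")
      case False
      then have "\<kappa> > 0" using \<kappa>0 by simp
      then show ?thesis using that by (simp add: KS a_def field_simps)
    qed (simp add: a_def)
    \<comment> \<open>Any \<open>b\<close> with \<open>a < b\<^sup>2 < 1\<close> and
      \<open>b > 0\<close> would do. With the weight \<open>b ^ h\<close> the two terms of
      \<open>expected_tv_le\<close> become \<open>(a / b) ^ h\<close> and \<open>b ^ h\<close>, and
      both decay.\<close>
    define b where "b = sqrt ((1 + a) / 2)"
    have b: "0 < b" "b < 1" "a < b * b" using a0 a1 by (auto simp: b_def)
    have "b * b < b * 1" using b by (intro mult_strict_left_mono)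
    then have "a < b" using b(3) by simp
    then have "a / b < 1" using b(1) by simp
    then have "(\<lambda>h. (a / b) ^ h + b ^ h) \<longlonglongrightarrow> 0 + 0"
      using b a0 by (intro tendsto_add LIMSEQ_realpow_zero) auto
    moreover have "?T h \<le> (a / b) ^ h + b ^ h" for h
    proof -
      have "ennreal (?T h) \<le> ennreal (1 / b ^ h) * ennreal (a ^ h) + ennreal (b ^ h)"
        using expected_tv_le[OF assms(3) \<kappa>, of "b ^ h" \<zeta> h] b by (simp add: energy)
      also have "\<dots> = ennreal ((a / b) ^ h + b ^ h)"
        using a0 b by (simp add: power_divide flip: ennreal_mult ennreal_plus)
      finally show ?thesis using a0 b by (subst (asm) ennreal_le_iff) auto
    qed
    ultimately show ?thesis
      unfolding non_reconstruction_def
      by (intro tendsto_sandwich[of "\<lambda>_. 0" ?T sequentially "\<lambda>h. (a / b) ^ h + b ^ h"])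
         (auto simp: expected_tv_nonneg)
  qed
  ultimately show ?thesis by blast
qed

end
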